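(* Let $M$ be a fixed $f$-implicit $\alpha$-Fréchet sup-measure with control measure $m$, i.e. $M(A)\sim\Phi^f_{\alpha,\kappa}(m(A)^{1/\alpha})$ for all $A\in\mathcal{E}_0$. Let $\mathcal{I}(M)$ be the set of all $M$-integrable functions $g:E\to[0,\infty)$. Then: (a) $\mathcal{I}(M)=L^{\alpha}_{+}(m)$ (in particular, $\mathcal{I}(M)$ is independent of $f$). (b) Let $g\in L^{\alpha}_{+}(m)$ and let $(g_n)$ be a sequence of simple functions with $g_n\uparrow g$. Then the sequence $(I(g_n))$ converges in probability, and its limit a.s. does not depend on the particular choice of the sequence of simple functions $(g_n)$ with $g_n\uparrow g$.
   Context: Loss function. Let $d\ge 1$ and let $f:\mathbb{R}^d\to[0,\infty)$ be fixed such that $f$ is continuous; $f(x)=0$ if and only if $x=0$; and $f(\lambda x)=\lambda f(x)$ for all $\lambda\ge 0$, $x\in\mathbb{R}^d$. Put $S=\{x\in\mathbb{R}^d: f(x)=1\}$ (a compact set). For $x_1,x_2\in\mathbb{R}^d$ let $x_1\vee_f x_2=x_1$ if $f(x_2)\le f(x_1)$ and $x_1\vee_f x_2=x_2$ if $f(x_1)<f(x_2)$. This operation is associative, and inductively $x_1\vee_f\cdots\vee_f x_k=(x_1\vee_f\cdots\vee_f x_{k-1})\vee_f x_k$. Fréchet laws. Fix $\alpha>0$. For $\sigma\ge0$, $\Phi_\alpha(\sigma)$ is the law of a real random variable $Z$ with $\mathbb{P}(Z\le x)=\exp(-\sigma^\alpha x^{-\alpha})$ for $x>0$ and $\mathbb{P}(Z\le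 x)=0$ for $x<0$ (so $\Phi_\alpha(0)$ is the point mass at $0$, and $\mathbb{P}(Z\le 0)=0$ if $\sigma>0$). Fix a probability measure $\kappa$ on $\mathcal{B}(S)$. An $\mathbb{R}^d$-valued random vector $Y$ has law $\Phi^f_{\alpha,\kappa}(\sigma)$ ($f$-implicit $\alpha$-Fréchet with scale $\sigma\ge 0$ and angular part $\kappa$) if $Y\overset{d}{=}\sigma Z\Theta$ with $Z\sim\Phi_\alpha(1)$ independent of the $S$-valued random vector $\Theta\sim\kappa$. Sup-measure. Let $(E,\mathcal{E},m)$ be a $\sigma$-finite measure space, $\mathcal{E}_0=\{A\in\mathcal{E}:m(A)<\infty\}$. On a probability space $(\Omega,\mathcal{A},\mathbb{P})$, $M$ is a map from $\mathcal{E}_0$ to the $\mathbb{R}^d$-valued random vectors such that: ($RM_1$) $M(A_1),\dots,M(A_k)$ are independent for finitely many disjoint $A_1,\dots,A_k\in\mathcal{E}_0$; ($RM_2$) for disjoint $A_1,A_2,\dots\in\mathcal{E}_0$ with $\bigcup_j A_j\in\mathcal{E}_0$, almost surely $M(\bigcup_j A_j)=\lim_{k\to\infty} M(A_1)\vee_f\cdots\vee_f M(A_k)=M(A_{j_0})$ for some random index $j_0$; and $M(A)\sim\Phi^f_{\alpha,\kappa}(m(A)^{1/\alpha})$ for every $A\in\mathcal{E}_0$. Integral of simple functions. A function $g:E\to[0,\infty)$ is simple if $g=\sum_{j=1}^k\alpha_j\mathbf{1}_{A_j}$ with $k\in\mathbb{N}$, $\alpha_j\ge0$ and disjoint $A_j\in\mathcal{E}_0$.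 Then $I(g):=\alpha_1M(A_1)\vee_f\cdots\vee_f\alpha_kM(A_k)$, which a.s. does not depend on the chosen representation of $g$. Function spaces and integrability. $L^\alpha_+(m)$ is the set of measurable $g:E\to[0,\infty)$ with $\|g\|_\alpha:=(\int_E g^\alpha\,dm)^{1/\alpha}<\infty$. $g_n\uparrow g$ means $g_n(s)\le g_{n+1}(s)$ for all $n\in\mathbb{N}$, $s\in E$ and $\lim_n g_n(s)=g(s)$ for all $s\in E$. A measurable function $g:E\to[0,\infty)$ is $M$-integrable if there exists a sequence of simple functions $g_n\uparrow g$ such that $(I(g_n))$ converges in probability on $\mathbb{R}^d$. *)

theory Defs
  imports "HOL-Probability.Probability" "HOL-Real_Asymp.Real_Asymp"
begin

section \<open>Loss functions and the operation induced by them\<close>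

definition loss_function :: "(real ^ 'n \<Rightarrow> real) \<Rightarrow> bool" where
  "loss_function f \<longleftrightarrow>
     continuous_on UNIV f \<and> (\<forall>x. 0 \<le> f x) \<and> (\<forall>x. f x = 0 \<longleftrightarrow> x = 0) \<and>
     (\<forall>c x. 0 \<le> c \<longrightarrow> f (c *\<^sub>R x) = c * f x)"

definition loss_sphere :: "(real ^ 'n \<Rightarrow> real) \<Rightarrow> (real ^ 'n) set" where
  "loss_sphere f = {x. f x = 1}"

definition fmax :: "(real ^ 'n \<Rightarrow> real) \<Rightarrow> real ^ 'n \<Rightarrow> real ^ 'n \<Rightarrow> real ^ 'n" where
  "fmax f x y = (if f y \<le> f x then x else y)"

text \<open>The maximum of the \<open>k + 1\<close> vectors \<open>x 0, \<dots>, x k\<close>, bracketed to the left.\<close>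

primrec fmax_upto :: "(real ^ 'n \<Rightarrow> real) \<Rightarrow> (nat \<Rightarrow> real ^ 'n) \<Rightarrow> nat \<Rightarrow> real ^ 'n" where
  "fmax_upto f x 0 = x 0"
| "fmax_upto f x (Suc k) = fmax f (fmax_upto f x k) (x (Suc k))"


section \<open>Frechet laws\<close>

text \<open>The value at \<open>x = 0\<close> is forced by right continuity. For \<open>\<sigma> = 0\<close> the exponential is \<open>1\<close>,
  so that the law is the point mass at \<open>0\<close>.\<close>

definition frechet_cdf :: "real \<Rightarrow> real \<Rightarrow> real \<Rightarrow> real" where
  "frechet_cdf \<alpha> \<sigma> x =
     (if 0 < x then exp (- (\<sigma> powr \<alpha> * x powr (- \<alpha>)))
      else if x = 0 \<and> \<sigma> = 0 then 1 else 0)"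

definition frechet :: "real \<Rightarrow> real \<Rightarrow> real measure" where
  "frechet \<alpha> \<sigma> = interval_measure (frechet_cdf \<alpha> \<sigma>)"

lemma
  assumes "0 < \<alpha>" "0 \<le> \<sigma>"
  shows real_distribution_frechet: "real_distribution (frechet \<alpha> \<sigma>)"
    and cdf_frechet: "cdf (frechet \<alpha> \<sigma>) = frechet_cdf \<alpha> \<sigma>"
proof -
  let ?F = "frechet_cdf \<alpha> \<sigma>"
  have mono: "?F x \<le> ?F y" if "x \<le> y" for x y
  proof (cases "0 < x")
    case True
    then have "y powr (- \<alpha>) \<le> x powr (- \<alpha>)"
      using that assms by (intro powr_mono2') auto
    then show ?thesis
      using True that by (auto simp: frechet_cdf_def intro!: mult_left_mono)
  next
    case False
    then show ?thesis
      using that assms by (auto simp: frechet_cdf_def)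
  qed
  have rc: "continuous (at_right a) ?F" for a
  proof -
    consider "a < 0" | "a = 0" | "0 < a" by linarith
    then have "(?F \<longlongrightarrow> ?F a) (at_right a)"
    proof cases
      case 1
      have "eventually (\<lambda>x. ?F x = 0) (at_right a)"
        using eventually_at_right_real[OF 1] by eventually_elim (auto simp: frechet_cdf_def)
      then show ?thesis
        using 1 by (simp add: frechet_cdf_def tendsto_eventually)
    next
      case 2
      have ev: "eventually (\<lambda>x. exp (- (\<sigma> powr \<alpha> * x powr (- \<alpha>))) = ?F x) (at_right 0)"
        using eventually_at_right_less[of "0::real"] by eventually_elim (auto simp: frechet_cdf_def)
      have "((\<lambda>x. exp (- (\<sigma> powr \<alpha> * x powr (- \<alpha>)))) \<longlongrightarrow> ?F 0) (at_right 0)"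
      proof (cases "\<sigma> = 0")
        case True
        then show ?thesis by (simp add: frechet_cdf_def)
      next
        case False
        define c where "c = \<sigma> powr \<alpha>"
        have "0 < c" using False by (simp add: c_def)
        then have "((\<lambda>x. exp (- (c * x powr (- \<alpha>)))) \<longlongrightarrow> 0) (at_right 0)"
          using assms(1) by real_asymp
        then show ?thesis
          using False by (simp add: frechet_cdf_def c_def)
      qed
      then have "(?F \<longlongrightarrow> ?F 0) (at_right 0)"
        using ev by (rule Lim_transform_eventually)
      then show ?thesis using 2 by simp
    next
      case 3
      have ev: "eventually (\<lambda>x. exp (- (\<sigma> powr \<alpha> * x powr (- \<alpha>))) = ?F x) (at_right a)"
        using eventually_at_right_less[of a] by eventually_elim (use 3 in \<open>auto simp: frechet_cdf_def\<close>)
      have "((\<lambda>x. exp (- (\<sigma> powr \<alpha> * x powr (- \<alpha>)))) \<longlongrightarrow> ?F a) (at_right a)"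
        using 3 by (auto simp: frechet_cdf_def intro!: tendsto_eq_intros)
      then show ?thesis
        using ev by (rule Lim_transform_eventually)
    qed
    then show ?thesis by (simp add: continuous_within)
  qed
  have bot: "(?F \<longlongrightarrow> 0) at_bot"
  proof (rule tendsto_eventually)
    show "eventually (\<lambda>x. ?F x = 0) at_bot"
      using eventually_gt_at_bot[of "0::real"] by eventually_elim (auto simp: frechet_cdf_def)
  qed
  have top: "(?F \<longlongrightarrow> 1) at_top"
  proof -
    have ev: "eventually (\<lambda>x. exp (- (\<sigma> powr \<alpha> * x powr (- \<alpha>))) = ?F x) at_top"
      using eventually_gt_at_top[of "0::real"] by eventually_elim (auto simp: frechet_cdf_def)
    have "((\<lambda>x::real. exp (- (\<sigma> powr \<alpha> * x powr (- \<alpha>)))) \<longlongrightarrow> 1) at_top"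
      using assms(1) by real_asymp
    then show ?thesis
      using ev by (rule Lim_transform_eventually)
  qed
  show "real_distribution (frechet \<alpha> \<sigma>)"
    unfolding frechet_def
    by (rule real_distribution_interval_measure) (fact mono rc bot top)+
  show "cdf (frechet \<alpha> \<sigma>) = ?F"
    unfolding frechet_def
    by (rule cdf_interval_measure) (fact mono rc bot top)+
qed

text \<open>The law of \<open>\<sigma> Z \<Theta>\<close>, where \<open>Z\<close> has law \<open>frechet \<alpha> 1\<close>, \<open>\<Theta>\<close> has law \<open>\<kappa>\<close>, and \<open>Z\<close> and \<open>\<Theta>\<close> are
  independent.\<close>

definition implicit_frechet ::
    "real \<Rightarrow> (real ^ 'n) measure \<Rightarrow> real \<Rightarrow> (real ^ 'n) measure" where
  "implicit_frechet \<alpha> \<kappa> \<sigma> =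
     distr (frechet \<alpha> 1 \<Otimes>\<^sub>M \<kappa>) borel (\<lambda>(z, \<theta>). (\<sigma> * z) *\<^sub>R \<theta>)"


section \<open>Sup-measures\<close>

definition finite_sets :: "'e measure \<Rightarrow> 'e set set" where
  "finite_sets m = {A \<in> sets m. emeasure m A < \<infinity>}"

text \<open>The last conjunct is \<open>\<sigma>\<close>-additivity for the operation \<open>fmax\<close>, the maximum being attained at a
  random (measurable) index \<open>j0\<close>.\<close>

definition frechet_sup_measure ::
    "(real ^ 'n \<Rightarrow> real) \<Rightarrow> real \<Rightarrow> (real ^ 'n) measure \<Rightarrow> 'e measure \<Rightarrow> 'w measure
      \<Rightarrow> ('e set \<Rightarrow> 'w \<Rightarrow> real ^ 'n) \<Rightarrow> bool" where
  "frechet_sup_measure f \<alpha> \<kappa> m P M \<longleftrightarrow>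
     (\<forall>A\<in>finite_sets m. M A \<in> borel_measurable P) \<and>
     (\<forall>A\<in>finite_sets m.
        distr P borel (M A) = implicit_frechet \<alpha> \<kappa> (measure m A powr (1 / \<alpha>))) \<and>
     (\<forall>(k::nat) A. (\<forall>j<k. A j \<in> finite_sets m) \<longrightarrow> disjoint_family_on A {..<k} \<longrightarrow>
        prob_space.indep_vars P (\<lambda>_. borel) (\<lambda>j. M (A j)) {..<k}) \<and>
     (\<forall>A::nat \<Rightarrow> 'e set. range A \<subseteq> finite_sets m \<longrightarrow> disjoint_family A \<longrightarrow>
        (\<Union>j. A j) \<in> finite_sets m \<longrightarrow>
        (\<exists>j0 \<in> measurable P (count_space UNIV). AE \<omega> in P.
           (\<lambda>k. fmax_upto f (\<lambda>j. M (A j) \<omega>) k) \<longlonglongrightarrow> M (\<Union>j. A j) \<omega> \<and>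
           M (\<Union>j. A j) \<omega> = M (A (j0 \<omega>)) \<omega>))"


section \<open>The integral of simple functions\<close>

text \<open>Functions on \<open>E = space m\<close> are represented by functions on the whole type; only their values
  on \<open>space m\<close> matter. A representation \<open>(k, a, A)\<close> has the \<open>k + 1\<close> terms with indices \<open>0, \<dots>, k\<close>.\<close>

definition simple_repr ::
    "'e measure \<Rightarrow> ('e \<Rightarrow> real) \<Rightarrow> nat \<times> (nat \<Rightarrow> real) \<times> (nat \<Rightarrow> 'e set) \<Rightarrow> bool" where
  "simple_repr m g = (\<lambda>(k, a, A).
     (\<forall>j\<le>k. 0 \<le> a j \<and> A j \<in> finite_sets m) \<and> disjoint_family_on A {..k} \<and>
     (\<forall>s\<in>space m. g s = (\<Sum>j\<le>k. a j * indicator (A j) s)))"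

definition simple_fun :: "'e measure \<Rightarrow> ('e \<Rightarrow> real) \<Rightarrow> bool" where
  "simple_fun m g \<longleftrightarrow> (\<exists>r. simple_repr m g r)"

definition repr_integral ::
    "(real ^ 'n \<Rightarrow> real) \<Rightarrow> ('e set \<Rightarrow> 'w \<Rightarrow> real ^ 'n)
      \<Rightarrow> nat \<times> (nat \<Rightarrow> real) \<times> (nat \<Rightarrow> 'e set) \<Rightarrow> 'w \<Rightarrow> real ^ 'n" where
  "repr_integral f M = (\<lambda>(k, a, A) \<omega>. fmax_upto f (\<lambda>j. a j *\<^sub>R M (A j) \<omega>) k)"

text \<open>For a sup-measure, different representations of \<open>g\<close> give almost surely equal values, so the
  choice fixes one version of a random vector that is determined up to null sets.\<close>

definition sup_integral ::
    "(real ^ 'n \<Rightarrow> real) \<Rightarrow> 'e measure \<Rightarrow> ('e set \<Rightarrow> 'w \<Rightarrow> real ^ 'n)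
      \<Rightarrow> ('e \<Rightarrow> real) \<Rightarrow> 'w \<Rightarrow> real ^ 'n" where
  "sup_integral f m M g = repr_integral f M (SOME r. simple_repr m g r)"


section \<open>Integrable functions\<close>

definition converges_in_prob ::
    "'w measure \<Rightarrow> (nat \<Rightarrow> 'w \<Rightarrow> 'b::euclidean_space) \<Rightarrow> ('w \<Rightarrow> 'b) \<Rightarrow> bool" where
  "converges_in_prob P X Y \<longleftrightarrow>
     (\<forall>n. X n \<in> borel_measurable P) \<and> Y \<in> borel_measurable P \<and>
     (\<forall>\<epsilon>>0. (\<lambda>n. measure P {\<omega> \<in> space P. \<epsilon> < dist (X n \<omega>) (Y \<omega>)}) \<longlonglongrightarrow> 0)"

definition simple_approx ::
    "'e measure \<Rightarrow> (nat \<Rightarrow> 'e \<Rightarrow> real) \<Rightarrow> ('e \<Rightarrow> real) \<Rightarrow> bool" where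
  "simple_approx m gs g \<longleftrightarrow>
     (\<forall>n. simple_fun m (gs n)) \<and>
     (\<forall>s\<in>space m. (\<forall>n. gs n s \<le> gs (Suc n) s) \<and> (\<lambda>n. gs n s) \<longlonglongrightarrow> g s)"

definition sup_integrable_functions ::
    "(real ^ 'n \<Rightarrow> real) \<Rightarrow> 'e measure \<Rightarrow> 'w measure \<Rightarrow> ('e set \<Rightarrow> 'w \<Rightarrow> real ^ 'n)
      \<Rightarrow> ('e \<Rightarrow> real) set" where
  "sup_integrable_functions f m P M =
     {g \<in> borel_measurable m. (\<forall>s\<in>space m. 0 \<le> g s) \<and>
        (\<exists>gs. simple_approx m gs g \<and>
          (\<exists>Y. converges_in_prob P (\<lambda>n. sup_integral f m M (gs n)) Y))}"

text \<open>The integral is finite if and only if its \<open>\<alpha>\<close>-th root, the \<open>\<alpha>\<close>-norm, is.\<close>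

definition Lp_plus :: "real \<Rightarrow> 'e measure \<Rightarrow> ('e \<Rightarrow> real) set" where
  "Lp_plus \<alpha> m =
     {g \<in> borel_measurable m. (\<forall>s\<in>space m. 0 \<le> g s) \<and>
        (\<integral>\<^sup>+ s. ennreal (g s powr \<alpha>) \<partial>m) < \<infinity>}"

end

theory Submission
  imports Defs
begin

text \<open>
  Why the theorem holds. The loss \<open>f (I g)\<close> of the integral of a simple function is a maximum of
  independent Frechet variables \<open>a j * f (M (A j))\<close>, hence itself Frechet, with scale the
  \<open>\<alpha>\<close>-norm of \<open>g\<close> (\<open>loss_repr_integral_le\<close>). If the integrals along \<open>gs n\<close> converge in
  probability they are bounded in probability, so the norms of \<open>gs n\<close> stay bounded and monotone
  convergence puts \<open>g\<close> into \<open>L\<^sup>\<alpha>\<close> (\<open>convergent_integrals_imp_Lp_plus\<close>).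

  For the converse the direction of the vectors has to be controlled as well. Two simple functions
  \<open>p\<close> and \<open>q\<close> are constant, with values \<open>u i\<close> and \<open>v i\<close>, on the parts \<open>C i\<close> of a common finite
  partition. Put \<open>c i = min (u i) (v i)\<close> and \<open>d i = max (u i) (v i)\<close>. If some part \<open>j\<close> satisfies
  \<open>c j * f (M (C j)) > 0\<close> and \<open>c j * f (M (C j)) > d i * f (M (C i))\<close> for all \<open>i \<noteq> j\<close>, then \<open>j\<close>
  decides both integrals:
  \<open>I p = u j *\<^sub>R M (C j)\<close> and \<open>I q = v j *\<^sub>R M (C j)\<close>, from whichever representations the integrals
  are computed (\<open>repr_integral_strict_maximum\<close>). The variables
  \<open>f (M (C i)) powr (- \<alpha>)\<close> are independent exponential clocks, so this happens with probability at
  least the quotient of the integrals of \<open>min p q powr \<alpha>\<close> and \<open>max p q powr \<alpha>\<close>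
  (\<open>frechet_dominance_prob\<close>). When this quotient is close to \<open>1\<close>, the ratio of \<open>u j\<close> and \<open>v j\<close> is
  close to \<open>1\<close> too, except on parts of small weight; together with the Frechet tail of \<open>I p\<close> and
  \<open>I q\<close> this bounds \<open>dist (I p) (I q)\<close> in probability (\<open>sup_integrals_close\<close>).

  If \<open>g\<close> has norm \<open>0\<close>, all integrals vanish almost surely. Otherwise members of two sequences that
  increase to the same \<open>g\<close> in \<open>L\<^sup>\<alpha>\<close> eventually have such a quotient, because their minima increase
  to \<open>g\<close> and their maxima stay below it. For one sequence this is the
  Cauchy property in probability and gives convergence; for two sequences it identifies the limits.
\<close>

section \<open>Convergence in probability\<close>

lemma (in prob_space) prob_tendsto_0_if_AE_eventually_notin:
  assumes A[measurable]: "\<And>n::nat. A n \<in> events"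
    and ev: "AE \<omega> in M. eventually (\<lambda>n. \<omega> \<notin> A n) sequentially"
  shows "(\<lambda>n. prob (A n)) \<longlonglongrightarrow> 0"
proof -
  have "(\<lambda>n. \<integral>\<omega>. indicator (A n) \<omega> \<partial>M) \<longlonglongrightarrow> (\<integral>\<omega>. (0::real) \<partial>M)"
  proof (rule integral_dominated_convergence[where w="\<lambda>_. 1"])
    show "AE \<omega> in M. (\<lambda>n. indicator (A n) \<omega> :: real) \<longlonglongrightarrow> 0"
      using ev
    proof eventually_elim
      case (elim \<omega>)
      then have "eventually (\<lambda>n. (indicator (A n) \<omega> :: real) = 0) sequentially"
        by eventually_elim auto
      then show ?case by (rule tendsto_eventually)
    qed
  qed (auto simp: indicator_def)
  then show ?thesis by simp
qed

lemma converges_in_probD: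
  "converges_in_prob P X Y \<Longrightarrow> 0 < \<epsilon> \<Longrightarrow>
    (\<lambda>n. measure P {\<omega> \<in> space P. \<epsilon> < dist (X n \<omega>) (Y \<omega>)}) \<longlonglongrightarrow> 0"
  by (simp add: converges_in_prob_def)

text \<open>Along a subsequence with summable error probabilities Borel and Cantelli give almost sure
  convergence; the Cauchy property then carries the limit over to the whole sequence.\<close>

lemma (in prob_space) cauchy_in_prob_imp_converges_in_prob:
  fixes X :: "nat \<Rightarrow> 'a \<Rightarrow> 'b::euclidean_space"
  assumes X[measurable]: "\<And>n. X n \<in> borel_measurable M"
    and C: "\<And>\<epsilon> \<eta>::real. 0 < \<epsilon> \<Longrightarrow> 0 < \<eta> \<Longrightarrow>
      \<exists>N. \<forall>n\<ge>N. \<forall>k\<ge>N. prob {\<omega> \<in> space M. \<epsilon> < dist (X n \<omega>) (X k \<omega>)} < \<eta>"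
  shows "\<exists>Y. converges_in_prob M X Y"
proof -
  have "\<forall>i::nat. \<exists>N. \<forall>n\<ge>N. \<forall>k\<ge>N. prob {\<omega> \<in> space M. (1/2)^i < dist (X n \<omega>) (X k \<omega>)} < (1/2)^i"
    using C by simp
  then obtain N where N:
    "\<And>i n k. n \<ge> N i \<Longrightarrow> k \<ge> N i \<Longrightarrow> prob {\<omega> \<in> space M. (1/2)^i < dist (X n \<omega>) (X k \<omega>)} < (1/2)^i"
    by metis
  define r where "r i = i + (\<Sum>j\<le>i. N j)" for i
  have r: "r i \<ge> N i" "r i \<ge> i" "r (Suc i) \<ge> r i" for i
    by (auto simp: r_def intro: trans_le_add2 member_le_sum)
  define A where "A i = {\<omega> \<in> space M. (1/2)^i < dist (X (r i) \<omega>) (X (r (Suc i)) \<omega>)}" for i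
  have [measurable]: "A i \<in> events" for i
    unfolding A_def by measurable
  have "summable (\<lambda>i. prob (A i))"
  proof (rule summable_comparison_test)
    show "\<exists>n0. \<forall>n\<ge>n0. norm (prob (A n)) \<le> (1/2)^n"
      using N[OF r(1) order_trans[OF r(1) r(3)]] by (auto simp: A_def intro!: less_imp_le)
  qed simp
  then have "AE \<omega> in M. eventually (\<lambda>i. \<omega> \<in> space M - A i) sequentially"
    by (intro borel_cantelli_AE1) (auto simp: less_top[symmetric])
  then have conv: "AE \<omega> in M. convergent (\<lambda>i. X (r i) \<omega>)"
  proof eventually_elim
    case (elim \<omega>)
    have "summable (\<lambda>i. X (r (Suc i)) \<omega> - X (r i) \<omega>)"
    proof (rule summable_comparison_test_ev)
      show "eventually (\<lambda>i. norm (X (r (Suc i)) \<omega> - X (r i) \<omega>) \<le> (1/2)^i) sequentially"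
        using elim by eventually_elim (auto simp: A_def dist_norm norm_minus_commute)
    qed simp
    then obtain l where "(\<lambda>n. \<Sum>i<n. X (r (Suc i)) \<omega> - X (r i) \<omega>) \<longlonglongrightarrow> l"
      using summable_LIMSEQ by blast
    then have "(\<lambda>n. (X (r n) \<omega> - X (r 0) \<omega>) + X (r 0) \<omega>) \<longlonglongrightarrow> l + X (r 0) \<omega>"
      using sum_lessThan_telescope[of "\<lambda>i. X (r i) \<omega>"] by (intro tendsto_add) auto
    then show ?case by (auto simp: convergent_def)
  qed
  define Y where "Y \<omega> = lim (\<lambda>i. X (r i) \<omega>)" for \<omega>
  have Y[measurable]: "Y \<in> borel_measurable M"
    unfolding Y_def by measurable
  have sub: "(\<lambda>i. prob {\<omega> \<in> space M. \<epsilon> < dist (X (r i) \<omega>) (Y \<omega>)}) \<longlonglongrightarrow> 0" if "0 < \<epsilon>" for \<epsilon>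
  proof (rule prob_tendsto_0_if_AE_eventually_notin)
    show "AE \<omega> in M. eventually (\<lambda>i. \<omega> \<notin> {\<omega> \<in> space M. \<epsilon> < dist (X (r i) \<omega>) (Y \<omega>)}) sequentially"
      using conv
    proof eventually_elim
      case (elim \<omega>)
      then have "(\<lambda>i. X (r i) \<omega>) \<longlonglongrightarrow> Y \<omega>"
        by (simp add: Y_def convergent_LIMSEQ_iff)
      from tendstoD[OF this that] show ?case
        by eventually_elim auto
    qed
  qed measurable
  have "(\<lambda>n. prob {\<omega> \<in> space M. \<epsilon> < dist (X n \<omega>) (Y \<omega>)}) \<longlonglongrightarrow> 0" if "0 < \<epsilon>" for \<epsilon>
  proof (rule LIMSEQ_I)
    fix \<eta> :: real assume "0 < \<eta>"
    obtain K where K: "\<And>n k. n \<ge> K \<Longrightarrow> k \<ge> K \<Longrightarrow>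
        prob {\<omega> \<in> space M. \<epsilon>/2 < dist (X n \<omega>) (X k \<omega>)} < \<eta>/2"
      using C[of "\<epsilon>/2" "\<eta>/2"] \<open>0 < \<epsilon>\<close> \<open>0 < \<eta>\<close> by auto
    obtain i where i: "i \<ge> K" "prob {\<omega> \<in> space M. \<epsilon>/2 < dist (X (r i) \<omega>) (Y \<omega>)} < \<eta>/2"
    proof -
      have "eventually (\<lambda>i. prob {\<omega> \<in> space M. \<epsilon>/2 < dist (X (r i) \<omega>) (Y \<omega>)} < \<eta>/2) sequentially"
        using \<open>0 < \<epsilon>\<close> \<open>0 < \<eta>\<close> by (intro order_tendstoD(2)[OF sub]) auto
      from eventually_happens[OF eventually_conj[OF this eventually_ge_at_top[of K]]]
      show ?thesis using that by auto
    qed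
    have "norm (prob {\<omega> \<in> space M. \<epsilon> < dist (X n \<omega>) (Y \<omega>)} - 0) < \<eta>" if "n \<ge> K" for n
    proof -
      have "prob {\<omega> \<in> space M. \<epsilon> < dist (X n \<omega>) (Y \<omega>)} \<le>
          prob ({\<omega> \<in> space M. \<epsilon>/2 < dist (X n \<omega>) (X (r i) \<omega>)} \<union>
                {\<omega> \<in> space M. \<epsilon>/2 < dist (X (r i) \<omega>) (Y \<omega>)})"
      proof (rule finite_measure_mono)
        have "\<epsilon>/2 < dist (X n \<omega>) (X (r i) \<omega>) \<or> \<epsilon>/2 < dist (X (r i) \<omega>) (Y \<omega>)"
          if "\<epsilon> < dist (X n \<omega>) (Y \<omega>)" for \<omega>
          using that dist_triangle[of "X n \<omega>" "Y \<omega>" "X (r i) \<omega>"] by linarith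
        then show "{\<omega> \<in> space M. \<epsilon> < dist (X n \<omega>) (Y \<omega>)}
            \<subseteq> {\<omega> \<in> space M. \<epsilon>/2 < dist (X n \<omega>) (X (r i) \<omega>)} \<union>
              {\<omega> \<in> space M. \<epsilon>/2 < dist (X (r i) \<omega>) (Y \<omega>)}" by blast
      qed measurable
      also have "\<dots> \<le> prob {\<omega> \<in> space M. \<epsilon>/2 < dist (X n \<omega>) (X (r i) \<omega>)} +
          prob {\<omega> \<in> space M. \<epsilon>/2 < dist (X (r i) \<omega>) (Y \<omega>)}"
        by (rule measure_Un_le) measurable
      also have "\<dots> < \<eta>"
        using K[OF that order_trans[OF i(1) r(2)]] i(2) by linarith
      finally show ?thesis by simp
    qed
    then show "\<exists>no. \<forall>n\<ge>no. norm (prob {\<omega> \<in> space M. \<epsilon> < dist (X n \<omega>) (Y \<omega>)} - 0) < \<eta>"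
      by blast
  qed
  then show ?thesis
    unfolding converges_in_prob_def using X Y by blast
qed

lemma (in prob_space) converges_in_prob_limits_AE_eq:
  fixes X X' :: "nat \<Rightarrow> 'a \<Rightarrow> 'b::euclidean_space"
  assumes XY: "converges_in_prob M X Y" and XY': "converges_in_prob M X' Y'"
    and D: "\<And>\<epsilon>. 0 < \<epsilon> \<Longrightarrow> (\<lambda>n. prob {\<omega> \<in> space M. \<epsilon> < dist (X n \<omega>) (X' n \<omega>)}) \<longlonglongrightarrow> 0"
  shows "AE \<omega> in M. Y \<omega> = Y' \<omega>"
proof -
  have [measurable]: "X n \<in> borel_measurable M" "X' n \<in> borel_measurable M"
      "Y \<in> borel_measurable M" "Y' \<in> borel_measurable M" for n
    using XY XY' by (auto simp: converges_in_prob_def)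
  have zero: "prob {\<omega> \<in> space M. \<epsilon> < dist (Y \<omega>) (Y' \<omega>)} = 0" if "0 < \<epsilon>" for \<epsilon>
  proof -
    let ?A = "\<lambda>n. {\<omega> \<in> space M. \<epsilon>/3 < dist (X n \<omega>) (Y \<omega>)}"
    let ?B = "\<lambda>n. {\<omega> \<in> space M. \<epsilon>/3 < dist (X n \<omega>) (X' n \<omega>)}"
    let ?C = "\<lambda>n. {\<omega> \<in> space M. \<epsilon>/3 < dist (X' n \<omega>) (Y' \<omega>)}"
    have e: "0 < \<epsilon>/3" using that by simp
    have "(\<lambda>n. prob (?A n) + prob (?B n) + prob (?C n)) \<longlonglongrightarrow> 0 + 0 + 0"
      using converges_in_probD[OF XY e] converges_in_probD[OF XY' e] D[OF e] by (intro tendsto_add)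
    moreover have "prob {\<omega> \<in> space M. \<epsilon> < dist (Y \<omega>) (Y' \<omega>)} \<le> prob (?A n) + prob (?B n) + prob (?C n)" for n
    proof -
      have tri: "\<epsilon>/3 < dist (X n \<omega>) (Y \<omega>) \<or> \<epsilon>/3 < dist (X n \<omega>) (X' n \<omega>) \<or> \<epsilon>/3 < dist (X' n \<omega>) (Y' \<omega>)"
        if "\<epsilon> < dist (Y \<omega>) (Y' \<omega>)" for \<omega>
        using that dist_triangle[of "Y \<omega>" "Y' \<omega>" "X n \<omega>"] dist_triangle[of "X n \<omega>" "Y' \<omega>" "X' n \<omega>"]
          dist_commute[of "X n \<omega>" "Y \<omega>"] by linarith
      have "prob {\<omega> \<in> space M. \<epsilon> < dist (Y \<omega>) (Y' \<omega>)} \<le> prob ((?A n \<union> ?B n) \<union> ?C n)"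
        using tri by (intro finite_measure_mono) (auto, measurable)
      also have "\<dots> \<le> prob (?A n \<union> ?B n) + prob (?C n)"
        by (rule measure_Un_le) measurable
      also have "prob (?A n \<union> ?B n) \<le> prob (?A n) + prob (?B n)"
        by (rule measure_Un_le) measurable
      finally show ?thesis by simp
    qed
    ultimately have "prob {\<omega> \<in> space M. \<epsilon> < dist (Y \<omega>) (Y' \<omega>)} \<le> 0"
      by (intro LIMSEQ_le_const[of _ 0]) auto
    then show ?thesis
      by (simp add: measure_le_0_iff)
  qed
  have "AE \<omega> in M. \<forall>i::nat. \<not> 1 / real (Suc i) < dist (Y \<omega>) (Y' \<omega>)"
    unfolding AE_all_countable
  proof
    fix i :: nat
    show "AE \<omega> in M. \<not> 1 / real (Suc i) < dist (Y \<omega>) (Y' \<omega>)"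
      using zero[of "1 / real (Suc i)"]
      by (subst AE_iff_measurable[OF _ refl]) (auto simp: emeasure_eq_measure)
  qed
  then show ?thesis
  proof eventually_elim
    case (elim \<omega>)
    show ?case
    proof (rule ccontr)
      assume "Y \<omega> \<noteq> Y' \<omega>"
      then obtain i where "inverse (real (Suc i)) < dist (Y \<omega>) (Y' \<omega>)"
        using reals_Archimedean[of "dist (Y \<omega>) (Y' \<omega>)"] by auto
      then show False using elim by (auto simp: inverse_eq_divide)
    qed
  qed
qed

text \<open>\<open>K\<close> is one more than a bound that the limit \<open>Y\<close> exceeds with small probability, which leaves
  room for \<open>dist (X n) Y \<le> 1\<close>.\<close>

lemma (in prob_space) converges_in_prob_imp_tight:
  fixes X :: "nat \<Rightarrow> 'a \<Rightarrow> 'b::euclidean_space"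
  assumes XY: "converges_in_prob M X Y" and "0 < \<eta>"
  shows "\<exists>K. eventually (\<lambda>n. prob {\<omega> \<in> space M. K < norm (X n \<omega>)} < \<eta>) sequentially"
proof -
  have [measurable]: "X n \<in> borel_measurable M" "Y \<in> borel_measurable M" for n
    using XY by (auto simp: converges_in_prob_def)
  have "(\<lambda>k::nat. prob {\<omega> \<in> space M. real k < norm (Y \<omega>)}) \<longlonglongrightarrow> 0"
  proof (rule prob_tendsto_0_if_AE_eventually_notin)
    have "eventually (\<lambda>k. \<omega> \<notin> {\<omega> \<in> space M. real k < norm (Y \<omega>)}) sequentially" for \<omega>
      using eventually_ge_at_top[of "nat \<lceil>norm (Y \<omega>)\<rceil>"]
      by eventually_elim (auto simp: not_less le_nat_iff nat_ceiling_le_eq)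
    then show "AE \<omega> in M. eventually (\<lambda>k. \<omega> \<notin> {\<omega> \<in> space M. real k < norm (Y \<omega>)}) sequentially"
      by simp
  qed measurable
  then have "eventually (\<lambda>k::nat. prob {\<omega> \<in> space M. real k < norm (Y \<omega>)} < \<eta>/2) sequentially"
    using \<open>0 < \<eta>\<close> by (intro order_tendstoD) auto
  then obtain k :: nat where k: "prob {\<omega> \<in> space M. real k < norm (Y \<omega>)} < \<eta>/2"
    by (auto dest: eventually_happens)
  have "eventually (\<lambda>n. prob {\<omega> \<in> space M. 1 < dist (X n \<omega>) (Y \<omega>)} < \<eta>/2) sequentially"
    using \<open>0 < \<eta>\<close> by (intro order_tendstoD(2)[OF converges_in_probD[OF XY]]) auto
  then have "eventually (\<lambda>n. prob {\<omega> \<in> space M. real k + 1 < norm (X n \<omega>)} < \<eta>) sequentially"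
  proof eventually_elim
    case (elim n)
    have tri: "real k < norm (Y \<omega>) \<or> 1 < dist (X n \<omega>) (Y \<omega>)" if "real k + 1 < norm (X n \<omega>)" for \<omega>
      using that norm_triangle_sub[of "X n \<omega>" "Y \<omega>"] by (auto simp: dist_norm)
    have "prob {\<omega> \<in> space M. real k + 1 < norm (X n \<omega>)} \<le>
        prob ({\<omega> \<in> space M. real k < norm (Y \<omega>)} \<union> {\<omega> \<in> space M. 1 < dist (X n \<omega>) (Y \<omega>)})"
      using tri by (intro finite_measure_mono) (auto, measurable)
    also have "\<dots> \<le> prob {\<omega> \<in> space M. real k < norm (Y \<omega>)} + prob {\<omega> \<in> space M. 1 < dist (X n \<omega>) (Y \<omega>)}"
      by (rule measure_Un_le) measurable
    finally show ?case using elim k by linarith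
  qed
  then show ?thesis by blast
qed

section \<open>Loss functions\<close>

lemma
  assumes "loss_function f"
  shows loss_function_nonneg: "0 \<le> f x"
    and loss_function_eq_0_iff: "f x = 0 \<longleftrightarrow> x = 0"
    and loss_function_scaleR: "0 \<le> c \<Longrightarrow> f (c *\<^sub>R x) = c * f x"
    and loss_function_continuous: "continuous_on UNIV f"
  using assms by (auto simp: loss_function_def)

lemma loss_function_measurable: "loss_function f \<Longrightarrow> f \<in> borel_measurable borel"
  by (intro borel_measurable_continuous_onI loss_function_continuous)

text \<open>On the compact Euclidean unit sphere \<open>f\<close> attains a positive minimum; homogeneity carries the
  resulting bound to all vectors.\<close>

lemma loss_function_norm_bound:
  fixes f :: "real ^ 'n \<Rightarrow> real"
  assumes f: "loss_function f"
  obtains C where "0 < C" "\<And>x. norm x \<le> C * f x"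
proof -
  let ?S = "sphere (0::real^'n) 1"
  obtain z where z: "z \<in> ?S" "\<And>y. y \<in> ?S \<Longrightarrow> f z \<le> f y"
    using continuous_attains_inf[of ?S f] continuous_on_subset[OF loss_function_continuous[OF f]]
    by (auto simp: compact_sphere)
  have pos: "0 < f z"
    using z(1) loss_function_nonneg[OF f, of z] loss_function_eq_0_iff[OF f, of z] by fastforce
  show thesis
  proof
    show "0 < 1 / f z" using pos by simp
    fix x
    show "norm x \<le> 1 / f z * f x"
    proof (cases "x = 0")
      case True
      then show ?thesis using loss_function_eq_0_iff[OF f, of 0] by simp
    next
      case False
      have "f z \<le> f ((1 / norm x) *\<^sub>R x)"
        using False by (intro z) simp
      also have "\<dots> = (1 / norm x) * f x"
        using False by (intro loss_function_scaleR[OF f]) simp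
      finally show ?thesis
        using False pos by (simp add: field_simps)
    qed
  qed
qed

lemma loss_function_bounded_on_balls:
  fixes f :: "real ^ 'n \<Rightarrow> real"
  assumes f: "loss_function f"
  obtains B where "0 < B" "\<And>x. norm x \<le> K \<Longrightarrow> f x \<le> B"
proof -
  have "compact (f ` cball 0 K)"
    by (intro compact_continuous_image continuous_on_subset[OF loss_function_continuous[OF f]]) auto
  then obtain B where B: "\<And>y. y \<in> f ` cball 0 K \<Longrightarrow> \<bar>y\<bar> \<le> B"
    using bounded_real compact_imp_bounded by metis
  show thesis
  proof
    show "0 < max B 1" by simp
    show "f x \<le> max B 1" if "norm x \<le> K" for x
      using B[of "f x"] that by (auto simp: le_max_iff_disj)
  qed
qed

lemma fmax_upto_mem: "fmax_upto f x k \<in> x ` {..k}"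
  by (induction k) (auto simp: fmax_def atMost_Suc)

lemma loss_le_fmax_upto: "j \<le> k \<Longrightarrow> f (x j) \<le> f (fmax_upto f x k)"
  by (induction k) (auto simp: fmax_def le_Suc_eq)

lemma loss_fmax_upto_le_iff: "f (fmax_upto f x k) \<le> y \<longleftrightarrow> (\<forall>j\<le>k. f (x j) \<le> y)"
  using fmax_upto_mem[of f x k] loss_le_fmax_upto[of _ k f x] by (auto intro: order_trans)

lemma fmax_upto_strict_maximum:
  assumes "j \<le> k" "\<And>i. i \<le> k \<Longrightarrow> i \<noteq> j \<Longrightarrow> f (x i) < f (x j)"
  shows "fmax_upto f x k = x j"
proof -
  obtain i where i: "i \<le> k" "fmax_upto f x k = x i"
    using fmax_upto_mem[of f x k] by auto
  then show ?thesis
    using loss_le_fmax_upto[OF assms(1), of f x] assms(2)[of i] by fastforce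
qed

lemma fmax_upto_measurable:
  assumes f: "loss_function f" and x: "\<And>j. j \<le> k \<Longrightarrow> x j \<in> borel_measurable P"
  shows "(\<lambda>\<omega>. fmax_upto f (\<lambda>j. x j \<omega>) k) \<in> borel_measurable P"
  using x
proof (induction k)
  case (Suc k)
  note [measurable] = Suc.IH[OF Suc.prems[OF le_SucI]] Suc.prems[OF order_refl]
    loss_function_measurable[OF f]
  show ?case by (simp add: fmax_def)
qed simp

section \<open>Independent Frechet variables\<close>

text \<open>The parameter \<open>w\<close> is the \<open>\<alpha>\<close>-th power of the scale: it adds up under maxima of independent
  variables. Only the values of the distribution function at \<open>x > 0\<close> are recorded; they determine
  the law of a nonnegative variable.\<close>

definition frechet_rv :: "'w measure \<Rightarrow> real \<Rightarrow> real \<Rightarrow> ('w \<Rightarrow> real) \<Rightarrow> bool" where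
  "frechet_rv P \<alpha> w X \<longleftrightarrow> X \<in> borel_measurable P \<and> (\<forall>\<omega>. 0 \<le> X \<omega>) \<and>
     (\<forall>x>0. measure P {\<omega> \<in> space P. X \<omega> \<le> x} = exp (- (w * x powr (- \<alpha>))))"

lemma
  assumes "frechet_rv P \<alpha> w X"
  shows frechet_rv_measurable: "X \<in> borel_measurable P"
    and frechet_rv_nonneg: "0 \<le> X \<omega>"
    and frechet_rv_prob_le: "0 < x \<Longrightarrow> measure P {\<omega> \<in> space P. X \<omega> \<le> x} = exp (- (w * x powr (- \<alpha>)))"
  using assms by (auto simp: frechet_rv_def)

context prob_space
begin

lemma frechet_rv_scale:
  assumes X: "frechet_rv M \<alpha> w X" and "0 \<le> c"
  shows "frechet_rv M \<alpha> (c powr \<alpha> * w) (\<lambda>\<omega>. c * X \<omega>)"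
proof -
  have [measurable]: "X \<in> borel_measurable M" using frechet_rv_measurable[OF X] .
  have "prob {\<omega> \<in> space M. c * X \<omega> \<le> x} = exp (- (c powr \<alpha> * w * x powr (- \<alpha>)))" if "0 < x" for x
  proof (cases "c = 0")
    case True
    then show ?thesis using that by (simp add: prob_space)
  next
    case False
    with \<open>0 \<le> c\<close> have "0 < c" by simp
    then have "{\<omega> \<in> space M. c * X \<omega> \<le> x} = {\<omega> \<in> space M. X \<omega> \<le> x / c}"
      by (auto simp: field_simps)
    then show ?thesis
      using frechet_rv_prob_le[OF X, of "x / c"] that \<open>0 < c\<close>
      by (simp add: powr_divide powr_minus field_simps)
  qed
  then show ?thesis
    using frechet_rv_nonneg[OF X] \<open>0 \<le> c\<close> by (auto simp: frechet_rv_def)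
qed

lemma frechet_rv_prob_less:
  assumes X: "frechet_rv M \<alpha> w X" and x: "0 < x"
  shows "prob {\<omega> \<in> space M. X \<omega> < x} = exp (- (w * x powr (- \<alpha>)))"
proof (rule antisym)
  note [measurable] = frechet_rv_measurable[OF X]
  have "prob {\<omega> \<in> space M. X \<omega> < x} \<le> prob {\<omega> \<in> space M. X \<omega> \<le> x}"
    by (intro finite_measure_mono) auto
  then show "prob {\<omega> \<in> space M. X \<omega> < x} \<le> exp (- (w * x powr (- \<alpha>)))"
    using frechet_rv_prob_le[OF X x] by simp
  have "((\<lambda>y. exp (- (w * y powr (- \<alpha>)))) \<longlongrightarrow> exp (- (w * x powr (- \<alpha>)))) (at_left x)"
    using x by (intro tendsto_intros) auto
  moreover have "eventually (\<lambda>y. exp (- (w * y powr (- \<alpha>))) \<le> prob {\<omega> \<in> space M. X \<omega> < x}) (at_left x)"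
    using eventually_at_left_real[OF x]
  proof eventually_elim
    case (elim y)
    then have "prob {\<omega> \<in> space M. X \<omega> \<le> y} \<le> prob {\<omega> \<in> space M. X \<omega> < x}"
      by (intro finite_measure_mono) auto
    then show ?case using frechet_rv_prob_le[OF X, of y] elim by simp
  qed
  ultimately show "exp (- (w * x powr (- \<alpha>))) \<le> prob {\<omega> \<in> space M. X \<omega> < x}"
    by (rule tendsto_upperbound) (simp add: trivial_limit_at_left_real)
qed

lemma frechet_rv_prob_le_0:
  assumes X: "frechet_rv M \<alpha> w X" and "0 < w" "0 < \<alpha>"
  shows "prob {\<omega> \<in> space M. X \<omega> \<le> 0} = 0"
proof -
  note [measurable] = frechet_rv_measurable[OF X]
  have "((\<lambda>x. exp (- (w * x powr (- \<alpha>)))) \<longlongrightarrow> 0) (at_right 0)"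
    using assms(2,3) by real_asymp
  moreover have "eventually (\<lambda>x. prob {\<omega> \<in> space M. X \<omega> \<le> 0} \<le> exp (- (w * x powr (- \<alpha>)))) (at_right 0)"
    using eventually_at_right_less[of "0::real"]
  proof eventually_elim
    case (elim x)
    then have "prob {\<omega> \<in> space M. X \<omega> \<le> 0} \<le> prob {\<omega> \<in> space M. X \<omega> \<le> x}"
      by (intro finite_measure_mono) auto
    then show ?case using frechet_rv_prob_le[OF X, of x] elim by simp
  qed
  ultimately have "prob {\<omega> \<in> space M. X \<omega> \<le> 0} \<le> 0"
    by (rule tendsto_lowerbound) simp
  then show ?thesis by (simp add: measure_le_0_iff)
qed

lemma frechet_rv_AE_pos:
  assumes X: "frechet_rv M \<alpha> w X" and "0 < w" "0 < \<alpha>"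
  shows "AE \<omega> in M. 0 < X \<omega>"
  using frechet_rv_prob_le_0[OF assms] frechet_rv_measurable[OF X]
  by (subst AE_iff_measurable[OF _ refl]) (auto simp: emeasure_eq_measure not_less)

text \<open>The decreasing map \<open>x \<mapsto> x powr (- \<alpha>)\<close> turns the distribution function
  \<open>exp (- (w * x powr (- \<alpha>)))\<close> into the tail \<open>exp (- (w * t))\<close>. At \<open>0\<close>, where \<open>powr\<close> has the
  value \<open>0\<close> instead of infinity, there is no mass because \<open>w > 0\<close>.\<close>

lemma frechet_rv_powr_exponential:
  assumes X: "frechet_rv M \<alpha> w X" and w: "0 < w" and \<alpha>: "0 < \<alpha>"
  shows "distributed M lborel (\<lambda>\<omega>. X \<omega> powr (- \<alpha>)) (exponential_density w)"
proof (rule exponential_distributedI)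
  note [measurable] = frechet_rv_measurable[OF X]
  show "(\<lambda>\<omega>. X \<omega> powr (- \<alpha>)) \<in> borel_measurable M" by measurable
  fix a :: real assume a: "0 \<le> a"
  have pos: "AE \<omega> in M. 0 < X \<omega>"
    by (rule frechet_rv_AE_pos[OF X w \<alpha>])
  have "prob {\<omega> \<in> space M. X \<omega> powr (- \<alpha>) \<le> a} = 1 - exp (- a * w)"
  proof (cases "a = 0")
    case True
    have "prob {\<omega> \<in> space M. X \<omega> powr (- \<alpha>) \<le> a} = prob {}"
      using pos True by (intro measure_eq_AE) (auto elim!: eventually_mono)
    then show ?thesis using True by simp
  next
    case False
    with a have "0 < a" by simp
    define b where "b = a powr (- 1 / \<alpha>)"
    have b: "0 < b" "b powr (- \<alpha>) = a"
      using \<open>0 < a\<close> \<alpha> by (auto simp: b_def powr_powr)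
    have iff: "x powr (- \<alpha>) \<le> a \<longleftrightarrow> \<not> x < b" if "0 < x" for x
    proof
      assume "x powr (- \<alpha>) \<le> a"
      then show "\<not> x < b"
        using powr_less_mono2_neg[of "- \<alpha>" x b] \<alpha> that b by auto
    next
      assume "\<not> x < b"
      then show "x powr (- \<alpha>) \<le> a"
        using powr_mono2'[of "- \<alpha>" b x] \<alpha> b by auto
    qed
    have "prob {\<omega> \<in> space M. X \<omega> powr (- \<alpha>) \<le> a} = prob (space M - {\<omega> \<in> space M. X \<omega> < b})"
      using pos by (intro measure_eq_AE) (auto elim!: eventually_mono simp: iff)
    also have "\<dots> = 1 - exp (- (w * b powr (- \<alpha>)))"
      using frechet_rv_prob_less[OF X b(1)] by (subst prob_compl) auto
    finally show ?thesis using b by (simp add: mult.commute)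
  qed
  then show "emeasure M {\<omega> \<in> space M. X \<omega> powr (- \<alpha>) \<le> a} = 1 - ennreal (exp (- a * w))"
    by (simp add: emeasure_eq_measure ennreal_minus ennreal_1[symmetric] del: ennreal_1)
qed (fact w)

lemma frechet_rv_family_prob:
  assumes I: "finite I" and ind: "indep_vars (\<lambda>_. borel) X I"
    and X: "\<And>i. i \<in> I \<Longrightarrow> frechet_rv M \<alpha> (w i) (X i)" and x: "0 < x"
  shows "prob {\<omega> \<in> space M. \<forall>i\<in>I. X i \<omega> \<le> x} = exp (- ((\<Sum>i\<in>I. w i) * x powr (- \<alpha>)))" (is ?le)
    and "prob {\<omega> \<in> space M. \<forall>i\<in>I. X i \<omega> < x} = exp (- ((\<Sum>i\<in>I. w i) * x powr (- \<alpha>)))" (is ?less)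
proof -
  have *: "prob {\<omega> \<in> space M. \<forall>i\<in>I. X i \<omega> \<in> A} = exp (- ((\<Sum>i\<in>I. w i) * x powr (- \<alpha>)))"
    if A: "A \<in> sets borel"
      and p: "\<And>i. i \<in> I \<Longrightarrow> prob {\<omega> \<in> space M. X i \<omega> \<in> A} = exp (- (w i * x powr (- \<alpha>)))" for A
  proof (cases "I = {}")
    case True
    then show ?thesis by (simp add: prob_space)
  next
    case False
    have "{\<omega> \<in> space M. \<forall>i\<in>I. X i \<omega> \<in> A} = (\<Inter>i\<in>I. X i -` A \<inter> space M)"
      using False by auto
    then have "prob {\<omega> \<in> space M. \<forall>i\<in>I. X i \<omega> \<in> A} = (\<Prod>i\<in>I. prob (X i -` A \<inter> space M))"
      using indep_varsD_finite[OF ind False I, of "\<lambda>_. A"] A by simp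
    also have "\<dots> = (\<Prod>i\<in>I. exp (- (w i * x powr (- \<alpha>))))"
      using p by (intro prod.cong) (auto simp: vimage_def Int_def conj_commute)
    also have "\<dots> = exp (- ((\<Sum>i\<in>I. w i) * x powr (- \<alpha>)))"
      using I by (simp add: exp_sum[symmetric] sum_negf sum_distrib_right)
    finally show ?thesis .
  qed
  show ?le using *[of "{..x}"] frechet_rv_prob_le[OF X x] by simp
  show ?less using *[of "{..<x}"] frechet_rv_prob_less[OF X x] by simp
qed

text \<open>The \<open>- \<alpha>\<close>-th power turns the family into independent exponential clocks with the rates
  \<open>w i\<close>, of which the smallest belongs to \<open>j\<close> with probability proportional to its rate. The
  integration is over the value of \<open>X j\<close>, the other variables entering only through their
  maximum.\<close>

lemma frechet_strict_maximum_prob: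
  assumes K: "finite K" "j \<notin> K" and ind: "indep_vars (\<lambda>_. borel) X (insert j K)"
    and X: "\<And>i. i \<in> insert j K \<Longrightarrow> frechet_rv M \<alpha> (w i) (X i)"
    and w: "0 < w j" "\<And>i. i \<in> K \<Longrightarrow> 0 \<le> w i" and \<alpha>: "0 < \<alpha>"
  shows "prob {\<omega> \<in> space M. 0 < X j \<omega> \<and> (\<forall>k\<in>K. X k \<omega> < X j \<omega>)} = w j / (\<Sum>i\<in>insert j K. w i)"
proof -
  have meas[measurable]: "X i \<in> borel_measurable M" if "i \<in> insert j K" for i
    using frechet_rv_measurable[OF X[OF that]] .
  have pos: "AE \<omega> in M. 0 < X j \<omega>"
    by (rule frechet_rv_AE_pos[OF X w(1) \<alpha>]) simp
  show ?thesis
  proof (cases "K = {}")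
    case True
    have "prob {\<omega> \<in> space M. 0 < X j \<omega> \<and> (\<forall>k\<in>K. X k \<omega> < X j \<omega>)} = prob {\<omega> \<in> space M. 0 < X j \<omega>}"
      using True by simp
    also have "\<dots> = 1"
      using pos by (subst prob_Collect_eq_1) auto
    finally show ?thesis using True w by simp
  next
    case False
    define W where "W = (\<Sum>i\<in>K. w i)"
    have W: "0 \<le> W" using w by (auto simp: W_def intro: sum_nonneg)
    \<comment> \<open>The sign change turns the maximum over \<open>K\<close> into a minimum, as in \<open>indep_vars_Min\<close>.\<close>
    define Y where "Y i = (\<lambda>\<omega>. if i = j then X i \<omega> else - X i \<omega>)" for i
    have "indep_vars (\<lambda>_. borel) (\<lambda>i \<omega>. (if i = j then id else uminus) (X i \<omega>)) (insert j K)"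
      by (rule indep_vars_compose2[OF ind]) auto
    then have "indep_vars (\<lambda>_. borel) Y (insert j K)"
      by (rule indep_vars_cong[THEN iffD1, rotated 3]) (auto simp: Y_def fun_eq_iff)
    from indep_vars_Min[OF K this]
    have iv: "indep_var borel (X j) borel (\<lambda>\<omega>. Min ((\<lambda>i. Y i \<omega>) ` K))"
      by (simp add: Y_def[of j])
    define V where "V = (\<lambda>\<omega>. Min ((\<lambda>i. Y i \<omega>) ` K))"
    have [measurable]: "V \<in> borel_measurable M"
      using indep_var_rv2[OF iv] by (simp add: V_def)
    have [measurable]: "X j \<in> borel_measurable M" by (rule meas) simp
    have V: "v < V \<omega> \<longleftrightarrow> (\<forall>k\<in>K. X k \<omega> < - v)" for v \<omega>
    proof -
      have "v < V \<omega> \<longleftrightarrow> (\<forall>k\<in>K. v < Y k \<omega>)"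
        using K False by (simp add: V_def)
      also have "\<dots> \<longleftrightarrow> (\<forall>k\<in>K. X k \<omega> < - v)"
        using K by (intro ball_cong) (auto simp: Y_def)
      finally show ?thesis .
    qed
    interpret V: prob_space "distr M borel V" by (rule prob_space_distr) simp
    let ?B = "{x::real \<times> real. 0 < fst x \<and> - fst x < snd x}"
    have B[measurable]: "?B \<in> sets (borel \<Otimes>\<^sub>M borel)"
    proof -
      have "{x \<in> space (borel \<Otimes>\<^sub>M borel). 0 < fst x \<and> - fst x < (snd x :: real)} \<in> sets (borel \<Otimes>\<^sub>M borel)"
        by measurable
      then show ?thesis by (simp add: space_pair_measure)
    qed
    have "emeasure M {\<omega> \<in> space M. 0 < X j \<omega> \<and> (\<forall>k\<in>K. X k \<omega> < X j \<omega>)} =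
        emeasure M ((\<lambda>\<omega>. (X j \<omega>, V \<omega>)) -` ?B \<inter> space M)"
      by (intro arg_cong[where f="emeasure M"]) (auto simp: V)
    also have "\<dots> = emeasure (distr M (borel \<Otimes>\<^sub>M borel) (\<lambda>\<omega>. (X j \<omega>, V \<omega>))) ?B"
      by (subst emeasure_distr) (use B in auto)
    also have "\<dots> = emeasure (distr M borel (X j) \<Otimes>\<^sub>M distr M borel V) ?B"
      using iv unfolding indep_var_distribution_eq by (simp add: V_def)
    also have "\<dots> = (\<integral>\<^sup>+x. emeasure (distr M borel V) (Pair x -` ?B) \<partial>distr M borel (X j))"
      using B by (intro V.emeasure_pair_measure_alt) simp
    also have "\<dots> = (\<integral>\<^sup>+x. (if 0 < x then ennreal (exp (- (W * x powr (- \<alpha>)))) else 0) \<partial>distr M borel (X j))"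
    proof (intro nn_integral_cong)
      fix x :: real
      show "emeasure (distr M borel V) (Pair x -` ?B) = (if 0 < x then ennreal (exp (- (W * x powr (- \<alpha>)))) else 0)"
      proof (cases "0 < x")
        case True
        have "Pair x -` ?B = {- x<..}" using True by auto
        then have "emeasure (distr M borel V) (Pair x -` ?B) = emeasure M (V -` {- x<..} \<inter> space M)"
          by (simp add: emeasure_distr)
        also have "V -` {- x<..} \<inter> space M = {\<omega> \<in> space M. \<forall>k\<in>K. X k \<omega> < x}"
          by (auto simp: V)
        also have "emeasure M \<dots> = ennreal (exp (- (W * x powr (- \<alpha>))))"
          unfolding W_def emeasure_eq_measure
          by (subst frechet_rv_family_prob(2)[OF K(1) indep_vars_subset[OF ind] X True]) auto
        finally show ?thesis using True by simp
      qed simp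
    qed
    also have "\<dots> = (\<integral>\<^sup>+\<omega>. (if 0 < X j \<omega> then ennreal (exp (- (W * X j \<omega> powr (- \<alpha>)))) else 0) \<partial>M)"
      by (rule nn_integral_distr) measurable
    also have "\<dots> = (\<integral>\<^sup>+\<omega>. ennreal (exp (- (W * X j \<omega> powr (- \<alpha>)))) \<partial>M)"
      using pos by (intro nn_integral_cong_AE) (auto elim!: eventually_mono)
    also have "\<dots> = (\<integral>\<^sup>+t. ennreal (exponential_density (w j) t) * ennreal (exp (- (W * t))) \<partial>lborel)"
      by (rule distributed_nn_integral[symmetric, OF frechet_rv_powr_exponential[OF X w(1) \<alpha>]]) auto
    also have "\<dots> = (\<integral>\<^sup>+t. ennreal (w j / (w j + W)) * ennreal (exponential_density (w j + W) t) \<partial>lborel)"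
    proof (intro nn_integral_cong)
      fix t :: real
      have "exponential_density (w j) t * exp (- (W * t)) = w j / (w j + W) * exponential_density (w j + W) t"
      proof (cases "t < 0")
        case False
        have "exp (- t * w j) * exp (- (W * t)) = exp (- t * (w j + W))"
          by (simp add: mult_exp_exp algebra_simps)
        moreover have "w j / (w j + W) * (w j + W) = w j"
          using w(1) W by simp
        ultimately show ?thesis
          using False by (simp add: exponential_density_def mult.assoc flip: times_divide_eq_left)
      qed (simp add: exponential_density_def)
      then show "ennreal (exponential_density (w j) t) * ennreal (exp (- (W * t))) =
          ennreal (w j / (w j + W)) * ennreal (exponential_density (w j + W) t)"
        using w(1) W by (simp add: ennreal_mult[symmetric] exponential_density_nonneg)
    qed
    also have "\<dots> = ennreal (w j / (w j + W)) * (\<integral>\<^sup>+t. ennreal (exponential_density (w j + W) t) \<partial>lborel)"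
      by (rule nn_integral_cmult) measurable
    also have "(\<integral>\<^sup>+t. ennreal (exponential_density (w j + W) t) \<partial>lborel) = 1"
      using prob_space.emeasure_space_1[OF prob_space_exponential_density[of "w j + W"]] w(1) W
      by (simp add: emeasure_density)
    finally have "prob {\<omega> \<in> space M. 0 < X j \<omega> \<and> (\<forall>k\<in>K. X k \<omega> < X j \<omega>)} = w j / (w j + W)"
      using w(1) W by (simp add: emeasure_eq_measure)
    then show ?thesis using K by (simp add: W_def)
  qed
qed

text \<open>The events that \<open>c j * X j\<close> beats every \<open>d k * X k\<close> with \<open>k \<noteq> j\<close> are disjoint for different
  \<open>j\<close>, since two such \<open>j\<close> would beat each other. Each is a strict maximum event for the multipliers
  \<open>c j\<close> at \<open>j\<close> and \<open>d k\<close> elsewhere, whose total rate is at most the one for \<open>d\<close>.\<close>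

lemma frechet_dominance_prob:
  assumes I: "finite I" and G: "G \<subseteq> I" and ind: "indep_vars (\<lambda>_. borel) X I"
    and X: "\<And>i. i \<in> I \<Longrightarrow> frechet_rv M \<alpha> (w i) (X i)"
    and w: "\<And>i. i \<in> I \<Longrightarrow> 0 \<le> w i" and \<alpha>: "0 < \<alpha>"
    and cd: "\<And>i. i \<in> I \<Longrightarrow> 0 \<le> c i" "\<And>i. i \<in> I \<Longrightarrow> c i \<le> d i"
  shows "(\<Sum>j\<in>G. c j powr \<alpha> * w j) / (\<Sum>i\<in>I. d i powr \<alpha> * w i) \<le>
    prob {\<omega> \<in> space M. \<exists>j\<in>G. 0 < c j * X j \<omega> \<and> (\<forall>k\<in>I - {j}. d k * X k \<omega> < c j * X j \<omega>)}"
proof -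
  have [measurable]: "X i \<in> borel_measurable M" if "i \<in> I" for i
    using frechet_rv_measurable[OF X[OF that]] .
  have finG: "finite G" using I G finite_subset by blast
  let ?D = "\<Sum>i\<in>I. d i powr \<alpha> * w i"
  define E where "E j = {\<omega> \<in> space M. 0 < c j * X j \<omega> \<and> (\<forall>k\<in>I - {j}. d k * X k \<omega> < c j * X j \<omega>)}" for j
  have E_meas: "E j \<in> events" if "j \<in> I" for j
  proof -
    have [measurable]: "X j \<in> borel_measurable M" "finite (I - {j})"
        "\<And>k. k \<in> I - {j} \<Longrightarrow> X k \<in> borel_measurable M"
      using frechet_rv_measurable[OF X] that I by auto
    show ?thesis unfolding E_def by measurable
  qed
  have le: "c j powr \<alpha> * w j / ?D \<le> prob (E j)" if j: "j \<in> I" for j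
  proof (cases "0 < c j powr \<alpha> * w j")
    case False
    moreover have "0 \<le> c j powr \<alpha> * w j" using w[OF j] by simp
    ultimately have "c j powr \<alpha> * w j = 0" by linarith
    then show ?thesis by (simp only: div_0 measure_nonneg)
  next
    case True
    define a where "a k = (if k = j then c k else d k)" for k
    have a: "0 \<le> a k" "a k \<le> d k" if "k \<in> I" for k
      using cd[OF that] by (auto simp: a_def)
    have ins: "insert j (I - {j}) = I" using j by auto
    have aw: "0 \<le> a k powr \<alpha> * w k" if "k \<in> I" for k using w[OF that] by simp
    have "prob {\<omega> \<in> space M. 0 < a j * X j \<omega> \<and> (\<forall>k\<in>I - {j}. a k * X k \<omega> < a j * X j \<omega>)} =
        a j powr \<alpha> * w j / (\<Sum>i\<in>insert j (I - {j}). a i powr \<alpha> * w i)"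
    proof (rule frechet_strict_maximum_prob)
      show "indep_vars (\<lambda>_. borel) (\<lambda>i \<omega>. a i * X i \<omega>) (insert j (I - {j}))"
        unfolding ins by (rule indep_vars_compose2[OF ind]) auto
      show "frechet_rv M \<alpha> (a i powr \<alpha> * w i) (\<lambda>\<omega>. a i * X i \<omega>)" if "i \<in> insert j (I - {j})" for i
        using that unfolding ins by (intro frechet_rv_scale X a)
    qed (use I True w in \<open>auto simp: a_def \<alpha>\<close>)
    moreover have "{\<omega> \<in> space M. 0 < a j * X j \<omega> \<and> (\<forall>k\<in>I - {j}. a k * X k \<omega> < a j * X j \<omega>)} = E j"
      by (auto simp: E_def a_def)
    ultimately have eq: "prob (E j) = c j powr \<alpha> * w j / (\<Sum>i\<in>I. a i powr \<alpha> * w i)"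
      unfolding ins by (simp add: a_def)
    have "(\<Sum>i\<in>I. a i powr \<alpha> * w i) \<le> ?D"
      using a w \<alpha> by (intro sum_mono mult_right_mono powr_mono2) auto
    moreover have "0 < (\<Sum>i\<in>I. a i powr \<alpha> * w i)"
    proof -
      have "a j powr \<alpha> * w j \<le> (\<Sum>i\<in>I. a i powr \<alpha> * w i)"
        using j I aw by (intro member_le_sum) auto
      then show ?thesis using True by (simp add: a_def)
    qed
    ultimately show ?thesis
      unfolding eq using True by (intro divide_left_mono) auto
  qed
  have disj: "disjoint_family_on E G"
  proof -
    have "False" if "i \<in> G" "j \<in> G" "i \<noteq> j" "\<omega> \<in> E i" "\<omega> \<in> E j" for i j \<omega>
    proof -
      have i: "i \<in> I" and j: "j \<in> I" using that G by auto
      have "c j * X j \<omega> \<le> d j * X j \<omega>" "c i * X i \<omega> \<le> d i * X i \<omega>"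
        using cd frechet_rv_nonneg[OF X] i j by (auto intro: mult_right_mono)
      moreover have "d j * X j \<omega> < c i * X i \<omega>" "d i * X i \<omega> < c j * X j \<omega>"
        using that i j by (auto simp: E_def)
      ultimately show False by linarith
    qed
    then show ?thesis unfolding disjoint_family_on_def by blast
  qed
  have "(\<Sum>j\<in>G. c j powr \<alpha> * w j) / ?D = (\<Sum>j\<in>G. c j powr \<alpha> * w j / ?D)"
    by (rule sum_divide_distrib)
  also have "\<dots> \<le> (\<Sum>j\<in>G. prob (E j))"
    using le G by (intro sum_mono) auto
  also have "\<dots> = prob (\<Union>j\<in>G. E j)"
    using finG disj G E_meas by (intro finite_measure_finite_Union[symmetric]) auto
  also have "(\<Union>j\<in>G. E j) =
      {\<omega> \<in> space M. \<exists>j\<in>G. 0 < c j * X j \<omega> \<and> (\<forall>k\<in>I - {j}. d k * X k \<omega> < c j * X j \<omega>)}"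
    by (auto simp: E_def)
  finally show ?thesis .
qed

end

section \<open>The laws of a sup-measure\<close>

text \<open>Homogeneity and \<open>f = 1\<close> on the sphere give \<open>f (\<sigma> Z \<Theta>) = \<sigma> Z\<close> for \<open>Z \<ge> 0\<close>, whatever the angle
  \<open>\<Theta>\<close>: the loss of an implicit Frechet vector is a Frechet variable.\<close>

lemma implicit_frechet_loss_le:
  fixes f :: "real ^ 'n \<Rightarrow> real"
  assumes f: "loss_function f" and \<alpha>: "0 < \<alpha>" and \<kappa>: "prob_space \<kappa>"
    and sets_\<kappa>: "sets \<kappa> = sets (restrict_space borel (loss_sphere f))"
    and \<sigma>: "0 \<le> \<sigma>" and x: "0 < x"
  shows "measure (implicit_frechet \<alpha> \<kappa> \<sigma>) {y. f y \<le> x} = exp (- (\<sigma> powr \<alpha> * x powr (- \<alpha>)))"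
proof -
  interpret \<kappa>: prob_space \<kappa> by (rule \<kappa>)
  interpret F: real_distribution "frechet \<alpha> 1"
    using \<alpha> by (intro real_distribution_frechet) auto
  have space_\<kappa>: "space \<kappa> = loss_sphere f"
    using sets_eq_imp_space_eq[OF sets_\<kappa>] by (simp add: space_restrict_space)
  have id_\<kappa>: "(\<lambda>x. x) \<in> measurable \<kappa> borel"
    by (subst measurable_cong_sets[OF sets_\<kappa> refl]) (rule measurable_restrict_space1, simp)
  have id_F: "(\<lambda>x. x) \<in> measurable (frechet \<alpha> 1) borel"
    by (subst measurable_cong_sets[OF F.events_eq_borel refl]) simp
  note [measurable] = loss_function_measurable[OF f]
  define h where "h = (\<lambda>p::real \<times> (real ^ 'n). (\<sigma> * fst p) *\<^sub>R snd p)"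
  have fst_m[measurable]: "fst \<in> measurable (frechet \<alpha> 1 \<Otimes>\<^sub>M \<kappa>) borel"
    by (rule measurable_compose[OF measurable_fst id_F])
  have snd_m[measurable]: "snd \<in> measurable (frechet \<alpha> 1 \<Otimes>\<^sub>M \<kappa>) borel"
    by (rule measurable_compose[OF measurable_snd id_\<kappa>])
  have h[measurable]: "h \<in> measurable (frechet \<alpha> 1 \<Otimes>\<^sub>M \<kappa>) borel"
    unfolding h_def by measurable
  have h_eq: "(\<lambda>(z, \<theta>). (\<sigma> * z) *\<^sub>R \<theta>) = h"
    by (auto simp: h_def fun_eq_iff)
  have pos: "AE z in frechet \<alpha> 1. 0 < z"
  proof -
    have "measure (frechet \<alpha> 1) {..0} = 0"
      using fun_cong[OF cdf_frechet[OF \<alpha>, of 1], of 0] by (simp add: cdf_def frechet_cdf_def)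
    then have "{..0} \<in> null_sets (frechet \<alpha> 1)"
      by (simp add: null_sets_def F.emeasure_eq_measure)
    then show ?thesis
      by (rule AE_I'[where N="{..0}"]) (auto simp: not_less)
  qed
  have meas_set: "{y. f y \<le> x} \<in> sets borel"
    by measurable
  have "emeasure (implicit_frechet \<alpha> \<kappa> \<sigma>) {y. f y \<le> x} =
      emeasure (frechet \<alpha> 1 \<Otimes>\<^sub>M \<kappa>) (h -` {y. f y \<le> x} \<inter> space (frechet \<alpha> 1 \<Otimes>\<^sub>M \<kappa>))"
    unfolding implicit_frechet_def h_eq by (rule emeasure_distr[OF h meas_set])
  also have "\<dots> = (\<integral>\<^sup>+z. emeasure \<kappa> (Pair z -` (h -` {y. f y \<le> x} \<inter> space (frechet \<alpha> 1 \<Otimes>\<^sub>M \<kappa>))) \<partial>frechet \<alpha> 1)"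
    by (rule \<kappa>.emeasure_pair_measure_alt[OF measurable_sets[OF h meas_set]])
  also have "\<dots> = (\<integral>\<^sup>+z. indicator {z. \<sigma> * z \<le> x} z \<partial>frechet \<alpha> 1)"
    using pos
  proof (intro nn_integral_cong_AE, eventually_elim)
    case (elim z)
    have "f (h (z, \<theta>)) = \<sigma> * z" if "\<theta> \<in> space \<kappa>" for \<theta>
      using that \<sigma> elim loss_function_scaleR[OF f, of "\<sigma> * z" \<theta>]
      by (simp add: h_def space_\<kappa> loss_sphere_def)
    then have "Pair z -` (h -` {y. f y \<le> x} \<inter> space (frechet \<alpha> 1 \<Otimes>\<^sub>M \<kappa>)) =
        (if \<sigma> * z \<le> x then space \<kappa> else {})"
      by (auto simp: space_pair_measure)
    then show ?case
      by (simp add: \<kappa>.emeasure_space_1)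
  qed
  also have "\<dots> = emeasure (frechet \<alpha> 1) {z. \<sigma> * z \<le> x}"
    by (rule nn_integral_indicator) simp
  finally have eq: "measure (implicit_frechet \<alpha> \<kappa> \<sigma>) {y. f y \<le> x} = measure (frechet \<alpha> 1) {z. \<sigma> * z \<le> x}"
    by (simp add: measure_def)
  show ?thesis
  proof (cases "\<sigma> = 0")
    case True
    then show ?thesis
      unfolding eq using x F.prob_space by simp
  next
    case False
    then have "{z. \<sigma> * z \<le> x} = {..x / \<sigma>}"
      using \<sigma> by (auto simp: field_simps)
    then have "measure (frechet \<alpha> 1) {z. \<sigma> * z \<le> x} = exp (- ((x / \<sigma>) powr (- \<alpha>)))"
      using fun_cong[OF cdf_frechet[OF \<alpha>, of 1], of "x / \<sigma>"] x \<sigma> False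
      by (simp add: cdf_def frechet_cdf_def)
    also have "(x / \<sigma>) powr (- \<alpha>) = \<sigma> powr \<alpha> * x powr (- \<alpha>)"
      using x \<sigma> by (simp add: powr_divide powr_minus field_simps)
    finally show ?thesis unfolding eq .
  qed
qed

locale sup_measure = prob_space P
  for P :: "'w measure" +
  fixes f :: "real ^ 'n \<Rightarrow> real" and \<alpha> :: real and \<kappa> :: "(real ^ 'n) measure"
    and m :: "'e measure" and M :: "'e set \<Rightarrow> 'w \<Rightarrow> real ^ 'n"
  assumes loss: "loss_function f"
    and \<alpha>: "0 < \<alpha>"
    and prob_\<kappa>: "prob_space \<kappa>" and sets_\<kappa>: "sets \<kappa> = sets (restrict_space borel (loss_sphere f))"
    and M: "frechet_sup_measure f \<alpha> \<kappa> m P M"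
begin

lemma M_measurable: "A \<in> finite_sets m \<Longrightarrow> M A \<in> borel_measurable P"
  using M by (auto simp: frechet_sup_measure_def)

lemma loss_M_frechet_rv:
  assumes A: "A \<in> finite_sets m"
  shows "frechet_rv P \<alpha> (measure m A) (\<lambda>\<omega>. f (M A \<omega>))"
proof -
  note [measurable] = loss_function_measurable[OF loss] M_measurable[OF A]
  have "prob {\<omega> \<in> space P. f (M A \<omega>) \<le> x} = exp (- (measure m A * x powr (- \<alpha>)))" if x: "0 < x" for x
  proof -
    have m: "{y. f y \<le> x} \<in> sets borel" by measurable
    have "prob {\<omega> \<in> space P. f (M A \<omega>) \<le> x} = measure (distr P borel (M A)) {y. f y \<le> x}"
      using m by (subst measure_distr) (auto intro!: arg_cong[where f=prob])
    also have "distr P borel (M A) = implicit_frechet \<alpha> \<kappa> (measure m A powr (1 / \<alpha>))"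
      using M A by (auto simp: frechet_sup_measure_def)
    also have "measure \<dots> {y. f y \<le> x} = exp (- ((measure m A powr (1 / \<alpha>)) powr \<alpha> * x powr (- \<alpha>)))"
      by (rule implicit_frechet_loss_le[OF loss \<alpha> prob_\<kappa> sets_\<kappa> _ x]) simp
    also have "(measure m A powr (1 / \<alpha>)) powr \<alpha> = measure m A"
      using \<alpha> by (simp add: powr_powr)
    finally show ?thesis .
  qed
  then show ?thesis
    using loss_function_nonneg[OF loss] by (auto simp: frechet_rv_def)
qed

text \<open>With scale \<open>0\<close> the distribution function of the loss is \<open>1\<close> at every \<open>x > 0\<close>.\<close>

lemma M_null:
  assumes A: "A \<in> finite_sets m" and null: "measure m A = 0"
  shows "AE \<omega> in P. M A \<omega> = 0"
proof -
  note X = loss_M_frechet_rv[OF A]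
  have "AE \<omega> in P. \<forall>i::nat. f (M A \<omega>) \<le> 1 / Suc i"
    unfolding AE_all_countable
  proof
    fix i :: nat
    have "{\<omega> \<in> space P. f (M A \<omega>) \<le> 1 / Suc i} \<in> events"
      using frechet_rv_measurable[OF X] by measurable
    moreover have "prob {\<omega> \<in> space P. f (M A \<omega>) \<le> 1 / Suc i} = 1"
      by (subst frechet_rv_prob_le[OF X]) (simp_all add: null)
    ultimately show "AE \<omega> in P. f (M A \<omega>) \<le> 1 / Suc i"
      by (rule prob_Collect_eq_1[THEN iffD1])
  qed
  then show ?thesis
  proof eventually_elim
    case (elim \<omega>)
    have "f (M A \<omega>) = 0"
    proof (rule ccontr)
      assume "f (M A \<omega>) \<noteq> 0"
      then have "0 < f (M A \<omega>)" using loss_function_nonneg[OF loss, of "M A \<omega>"] by simp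
      then obtain i where "inverse (real (Suc i)) < f (M A \<omega>)"
        using reals_Archimedean by blast
      then show False using elim[rule_format, of i] by (simp add: inverse_eq_divide)
    qed
    then show ?case using loss_function_eq_0_iff[OF loss] by simp
  qed
qed

lemma empty_finite_set: "{} \<in> finite_sets m"
  by (simp add: finite_sets_def)

text \<open>The finite index set is enumerated and continued by empty sets, on which \<open>M\<close> vanishes almost
  surely; the alternative \<open>M (\<Union>i\<in>I. C i) \<omega> = 0\<close> arises when \<open>j0\<close> selects one of them. The losses
  of the partial maxima increase to the loss of the limit by continuity of \<open>f\<close>.\<close>

lemma M_finite_Union:
  assumes I: "finite I" and C: "\<And>i. i \<in> I \<Longrightarrow> C i \<in> finite_sets m" and disj: "disjoint_family_on C I"
  shows "AE \<omega> in P. (\<forall>i\<in>I. f (M (C i) \<omega>) \<le> f (M (\<Union>i\<in>I. C i) \<omega>)) \<and>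
    (M (\<Union>i\<in>I. C i) \<omega> = 0 \<or> (\<exists>i\<in>I. M (\<Union>i\<in>I. C i) \<omega> = M (C i) \<omega>))"
proof -
  obtain e where e: "bij_betw e {..<card I} I"
    using ex_bij_betw_nat_finite[OF I] by (auto simp: atLeast0LessThan)
  define A where "A n = (if n < card I then C (e n) else {})" for n
  have eI: "e n \<in> I" if "n < card I" for n
    using e that by (auto simp: bij_betw_def)
  have A: "range A \<subseteq> finite_sets m"
    using C eI empty_finite_set by (auto simp: A_def)
  have dA: "disjoint_family A"
    using disj e eI by (auto simp: disjoint_family_on_def A_def bij_betw_def inj_on_def) blast
  have UA: "(\<Union>n. A n) = (\<Union>i\<in>I. C i)"
  proof -
    have "(\<Union>n. A n) = (\<Union>n\<in>{..<card I}. C (e n))"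
      by (auto simp: A_def split: if_splits)
    also have "\<dots> = (\<Union>i\<in>e ` {..<card I}. C i)" by simp
    finally show ?thesis unfolding bij_betw_imp_surj_on[OF e] .
  qed
  have UF: "(\<Union>i\<in>I. C i) \<in> finite_sets m"
  proof -
    have "emeasure m (\<Union>i\<in>I. C i) \<le> (\<Sum>i\<in>I. emeasure m (C i))"
      using C I by (intro emeasure_subadditive_finite) (auto simp: finite_sets_def)
    also have "\<dots> < \<infinity>"
      using C I by (auto simp: finite_sets_def less_top)
    finally show ?thesis using C I by (auto simp: finite_sets_def)
  qed
  obtain j0 where j0: "AE \<omega> in P.
      (\<lambda>k. fmax_upto f (\<lambda>j. M (A j) \<omega>) k) \<longlonglongrightarrow> M (\<Union>i\<in>I. C i) \<omega> \<and>
      M (\<Union>i\<in>I. C i) \<omega> = M (A (j0 \<omega>)) \<omega>"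
    using M A dA UF unfolding frechet_sup_measure_def UA[symmetric] by blast
  have "AE \<omega> in P. M {} \<omega> = 0"
    by (rule M_null[OF empty_finite_set]) simp
  with j0 show ?thesis
  proof eventually_elim
    case (elim \<omega>)
    let ?U = "M (\<Union>i\<in>I. C i) \<omega>"
    have lim: "(\<lambda>k. f (fmax_upto f (\<lambda>j. M (A j) \<omega>) k)) \<longlonglongrightarrow> f ?U"
      using elim loss_function_continuous[OF loss]
      by (intro continuous_on_tendsto_compose[of UNIV f]) auto
    have "f (M (C i) \<omega>) \<le> f ?U" if "i \<in> I" for i
    proof -
      obtain n where n: "n < card I" "i = e n"
        using bij_betw_imp_surj_on[OF e] \<open>i \<in> I\<close> by blast
      have "\<exists>N. \<forall>k\<ge>N. f (M (A n) \<omega>) \<le> f (fmax_upto f (\<lambda>j. M (A j) \<omega>) k)"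
        using loss_le_fmax_upto[of n _ f "\<lambda>j. M (A j) \<omega>"] by blast
      from LIMSEQ_le_const[OF lim this] show ?thesis
        using n by (simp add: A_def)
    qed
    moreover have "?U = 0 \<or> (\<exists>i\<in>I. ?U = M (C i) \<omega>)"
      using elim eI by (cases "j0 \<omega> < card I") (auto simp: A_def)
    ultimately show ?case by blast
  qed
qed

lemma M_indep_vars:
  assumes I: "finite I" and C: "\<And>i. i \<in> I \<Longrightarrow> C i \<in> finite_sets m" and disj: "disjoint_family_on C I"
  shows "indep_vars (\<lambda>_. borel) (\<lambda>i \<omega>. f (M (C i) \<omega>)) I"
proof -
  obtain e where e: "bij_betw e {..<card I} I"
    using ex_bij_betw_nat_finite[OF I] by (auto simp: atLeast0LessThan)
  define e' where "e' = the_inv_into {..<card I} e"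
  have e': "bij_betw e' I {..<card I}"
    using e by (simp add: e'_def bij_betw_the_inv_into)
  have ee': "e (e' i) = i" if "i \<in> I" for i
    using e that by (simp add: e'_def f_the_inv_into_f_bij_betw)
  have eI: "e n \<in> I" if "n < card I" for n
    using e that by (auto simp: bij_betw_def)
  have "disjoint_family_on (\<lambda>n. C (e n)) {..<card I}"
    using disj e eI by (auto simp: disjoint_family_on_def bij_betw_def inj_on_def) blast
  then have "indep_vars (\<lambda>_. borel) (\<lambda>n. M (C (e n))) {..<card I}"
    using M C eI unfolding frechet_sup_measure_def by (elim conjE allE[of _ "card I"] allE[of _ "\<lambda>n. C (e n)"]) auto
  then have ind: "indep_vars (\<lambda>_. borel) (\<lambda>n \<omega>. f (M (C (e n)) \<omega>)) {..<card I}"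
    using loss_function_measurable[OF loss] by (intro indep_vars_compose2[where Y="\<lambda>_. f"]) auto
  show ?thesis
    unfolding indep_vars_def2
  proof (intro conjI ballI)
    fix i assume "i \<in> I"
    then show "random_variable borel (\<lambda>\<omega>. f (M (C i) \<omega>))"
      using frechet_rv_measurable[OF loss_M_frechet_rv[OF C]] by blast
  next
    let ?F = "\<lambda>i. {(\<lambda>\<omega>. f (M (C i) \<omega>)) -` A \<inter> space P | A. A \<in> sets borel}"
    have sets: "indep_sets (\<lambda>n. ?F (e n)) {..<card I}"
      using ind by (simp add: indep_vars_def2)
    show "indep_sets ?F I"
    proof (rule indep_setsI)
      fix i assume "i \<in> I"
      then show "?F i \<subseteq> events"
        using frechet_rv_measurable[OF loss_M_frechet_rv[OF C]] by (auto intro: measurable_sets)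
    next
      fix A J assume J: "J \<noteq> {}" "J \<subseteq> I" "finite J" "\<forall>j\<in>J. A j \<in> ?F j"
      have inj: "inj_on e' J" using e' J by (meson bij_betw_imp_inj_on inj_on_subset)
      have JI: "e (e' j) = j" if "j \<in> J" for j using ee' J that by blast
      have "prob (\<Inter>n\<in>e' ` J. A (e n)) = (\<Prod>n\<in>e' ` J. prob (A (e n)))"
      proof (rule indep_setsD[OF sets])
        show "e' ` J \<subseteq> {..<card I}" using bij_betw_imp_surj_on[OF e'] J by blast
        show "\<forall>n\<in>e' ` J. A (e n) \<in> ?F (e n)" using J(4) JI by simp
      qed (use J in auto)
      also have "\<dots> = (\<Prod>j\<in>J. prob (A j))"
        using JI by (simp add: prod.reindex[OF inj])
      also have "(\<Inter>n\<in>e' ` J. A (e n)) = (\<Inter>j\<in>J. A j)"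
        using JI by simp
      finally show "prob (\<Inter>j\<in>J. A j) = (\<Prod>j\<in>J. prob (A j))" .
    qed
  qed
qed

end

section \<open>Step functions\<close>

lemma simple_reprD:
  assumes "simple_repr m g (k, a, A)"
  shows simple_repr_coeff: "j \<le> k \<Longrightarrow> 0 \<le> a j"
    and simple_repr_sets: "j \<le> k \<Longrightarrow> A j \<in> finite_sets m"
    and simple_repr_disjoint: "disjoint_family_on A {..k}"
    and simple_repr_on: "j \<le> k \<Longrightarrow> s \<in> A j \<Longrightarrow> g s = a j"
    and simple_repr_off: "s \<in> space m \<Longrightarrow> (\<And>j. j \<le> k \<Longrightarrow> s \<notin> A j) \<Longrightarrow> g s = 0"
proof -
  show A: "0 \<le> a j" "A j \<in> finite_sets m" if "j \<le> k" for j
    using assms that by (auto simp: simple_repr_def)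
  show disj: "disjoint_family_on A {..k}"
    using assms by (auto simp: simple_repr_def)
  have g: "g s = (\<Sum>j\<le>k. a j * indicator (A j) s)" if "s \<in> space m" for s
    using assms that by (auto simp: simple_repr_def)
  show "g s = a j" if "j \<le> k" "s \<in> A j"
  proof -
    have "s \<in> space m" using A[OF that(1)] that(2) sets.sets_into_space by (auto simp: finite_sets_def)
    then show ?thesis
      using that sum_indicator_disjoint_family[OF disj that(2), of a] by (simp add: g)
  qed
  show "g s = 0" if "s \<in> space m" "\<And>j. j \<le> k \<Longrightarrow> s \<notin> A j"
    using that by (simp add: g)
qed

lemma simple_fun_measurable:
  assumes "simple_fun m g"
  shows "g \<in> borel_measurable m"
proof -
  obtain k a A where r: "simple_repr m g (k, a, A)"
    using assms by (auto simp: simple_fun_def)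
  have [measurable]: "A j \<in> sets m" if "j \<le> k" for j
    using simple_repr_sets[OF r that] by (simp add: finite_sets_def)
  have "(\<lambda>s. \<Sum>j\<le>k. a j * indicator (A j) s) \<in> borel_measurable m"
    by measurable
  then show ?thesis
    using r by (subst measurable_cong) (auto simp: simple_repr_def)
qed

lemma simple_fun_nonneg:
  assumes "simple_fun m g" "s \<in> space m"
  shows "0 \<le> g s"
  using assms by (auto simp: simple_fun_def simple_repr_def intro!: sum_nonneg)

definition step_on :: "'e measure \<Rightarrow> 'i set \<Rightarrow> ('i \<Rightarrow> 'e set) \<Rightarrow> ('i \<Rightarrow> real) \<Rightarrow> ('e \<Rightarrow> real) \<Rightarrow> bool" where
  "step_on m I C u g \<longleftrightarrow> finite I \<and> (\<forall>i\<in>I. C i \<in> finite_sets m) \<and> disjoint_family_on C I \<and>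
     (\<forall>i\<in>I. 0 \<le> u i \<and> (\<forall>s\<in>C i. g s = u i)) \<and> (\<forall>s\<in>space m. (\<forall>i\<in>I. s \<notin> C i) \<longrightarrow> g s = 0)"

lemma simple_repr_step_on: "simple_repr m g (k, a, A) \<Longrightarrow> step_on m {..k} A a g"
  by (auto simp: step_on_def dest: simple_reprD)

lemma step_on_combine:
  assumes "step_on m I C u p" "step_on m I C v q" "\<phi> 0 0 = 0" "\<And>x y. 0 \<le> x \<Longrightarrow> 0 \<le> y \<Longrightarrow> 0 \<le> \<phi> x y"
  shows "step_on m I C (\<lambda>i. \<phi> (u i) (v i)) (\<lambda>s. \<phi> (p s) (q s))"
  using assms by (auto simp: step_on_def)

lemma step_nn_integral_powr:
  fixes u :: "'i \<Rightarrow> real"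
  assumes g: "step_on m I C u g"
  shows "(\<integral>\<^sup>+s. ennreal (g s powr \<alpha>) \<partial>m) = ennreal (\<Sum>i\<in>I. u i powr \<alpha> * measure m (C i))"
proof -
  have I: "finite I" and C: "\<And>i. i \<in> I \<Longrightarrow> C i \<in> finite_sets m" and disj: "disjoint_family_on C I"
    and on: "\<And>i s. i \<in> I \<Longrightarrow> s \<in> C i \<Longrightarrow> g s = u i"
    and off: "\<And>s. s \<in> space m \<Longrightarrow> (\<And>i. i \<in> I \<Longrightarrow> s \<notin> C i) \<Longrightarrow> g s = 0"
    using g by (auto simp: step_on_def)
  have "(\<integral>\<^sup>+s. ennreal (g s powr \<alpha>) \<partial>m) = (\<integral>\<^sup>+s. (\<Sum>i\<in>I. ennreal (u i powr \<alpha>) * indicator (C i) s) \<partial>m)"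
  proof (rule nn_integral_cong)
    fix s assume s: "s \<in> space m"
    show "ennreal (g s powr \<alpha>) = (\<Sum>i\<in>I. ennreal (u i powr \<alpha>) * indicator (C i) s)"
    proof (cases "\<exists>i\<in>I. s \<in> C i")
      case True
      then obtain i where i: "i \<in> I" "s \<in> C i" by blast
      show ?thesis
        unfolding on[OF i]
        by (rule sum_indicator_disjoint_family[OF disj i(2) I i(1), symmetric])
    next
      case False
      then have "(\<Sum>i\<in>I. ennreal (u i powr \<alpha>) * indicator (C i) s) = 0"
        by (intro sum.neutral) auto
      then show ?thesis
        using off[OF s] False by simp
    qed
  qed
  also have "\<dots> = (\<Sum>i\<in>I. (\<integral>\<^sup>+s. ennreal (u i powr \<alpha>) * indicator (C i) s \<partial>m))"
  proof (rule nn_integral_sum)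
    fix i assume "i \<in> I"
    then have [measurable]: "C i \<in> sets m" using C by (simp add: finite_sets_def)
    show "(\<lambda>s. ennreal (u i powr \<alpha>) * indicator (C i) s) \<in> borel_measurable m" by measurable
  qed
  also have "\<dots> = (\<Sum>i\<in>I. ennreal (u i powr \<alpha> * measure m (C i)))"
  proof (rule sum.cong[OF refl])
    fix i assume "i \<in> I"
    from C[OF this] have Ci: "C i \<in> sets m" "emeasure m (C i) \<noteq> top" by (auto simp: finite_sets_def)
    have "(\<integral>\<^sup>+s. ennreal (u i powr \<alpha>) * indicator (C i) s \<partial>m) = ennreal (u i powr \<alpha>) * emeasure m (C i)"
      by (rule nn_integral_cmult_indicator[OF Ci(1)])
    also have "\<dots> = ennreal (u i powr \<alpha> * measure m (C i))"
      by (simp add: emeasure_eq_ennreal_measure[OF Ci(2)] ennreal_mult')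
    finally show "(\<integral>\<^sup>+s. ennreal (u i powr \<alpha>) * indicator (C i) s \<partial>m) = ennreal (u i powr \<alpha> * measure m (C i))" .
  qed
  also have "\<dots> = ennreal (\<Sum>i\<in>I. u i powr \<alpha> * measure m (C i))"
    by (intro sum_ennreal) auto
  finally show ?thesis .
qed

text \<open>The partition \<open>C\<close> refines the representation \<open>(k, a, A)\<close> if every \<open>A j\<close> is the union of the
  parts with label \<open>h i = j\<close>; the labels above \<open>k\<close> mark the parts outside all \<open>A j\<close>, where the
  represented function vanishes.\<close>

definition refines ::
    "'i set \<Rightarrow> ('i \<Rightarrow> 'e set) \<Rightarrow> ('i \<Rightarrow> real) \<Rightarrow> ('i \<Rightarrow> nat)
      \<Rightarrow> nat \<times> (nat \<Rightarrow> real) \<times> (nat \<Rightarrow> 'e set) \<Rightarrow> bool" where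
  "refines I C u h = (\<lambda>(k, a, A).
     (\<forall>j\<le>k. A j = (\<Union>i\<in>{i \<in> I. h i = j}. C i)) \<and>
     (\<forall>i\<in>I. u i = (if h i \<le> k then a (h i) else 0)))"

text \<open>Both families of sets are first completed to partitions of the union \<open>U\<close> of all sets, by a last
  set with coefficient \<open>0\<close>; the parts are the pairwise intersections. Completing within \<open>U\<close>
  instead of the whole space keeps the measures finite.\<close>

lemma common_refinement:
  assumes r: "simple_repr m p (k, a, A)" and r': "simple_repr m q (l, b, B)"
  shows "\<exists>(I :: (nat \<times> nat) set) C u v h h'. step_on m I C u p \<and> step_on m I C v q \<and>
    refines I C u h (k, a, A) \<and> refines I C v h' (l, b, B)"
proof -
  define U where "U = (\<Union>j\<le>k. A j) \<union> (\<Union>j\<le>l. B j)"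
  define A' where "A' j = (if j \<le> k then A j else U - (\<Union>j\<le>k. A j))" for j
  define B' where "B' j = (if j \<le> l then B j else U - (\<Union>j\<le>l. B j))" for j
  define I where "I = {..Suc k} \<times> {..Suc l}"
  define C where "C = (\<lambda>(i, j). A' i \<inter> B' j)"
  define u where "u = (\<lambda>(i, j::nat). if i \<le> k then a i else 0)"
  define v where "v = (\<lambda>(i::nat, j). if j \<le> l then b j else 0)"
  have A: "A j \<in> sets m" "emeasure m (A j) < \<infinity>" if "j \<le> k" for j
    using simple_repr_sets[OF r that] by (auto simp: finite_sets_def)
  have B: "B j \<in> sets m" "emeasure m (B j) < \<infinity>" if "j \<le> l" for j
    using simple_repr_sets[OF r' that] by (auto simp: finite_sets_def)
  have Us: "U \<in> sets m" unfolding U_def using A B by auto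
  have Uspace: "U \<subseteq> space m" using Us by (rule sets.sets_into_space)
  have Um: "emeasure m U < \<infinity>"
  proof -
    have "emeasure m U \<le> emeasure m (\<Union>j\<le>k. A j) + emeasure m (\<Union>j\<le>l. B j)"
      unfolding U_def using A B by (intro emeasure_subadditive) auto
    also have "\<dots> \<le> (\<Sum>j\<le>k. emeasure m (A j)) + (\<Sum>j\<le>l. emeasure m (B j))"
      using A B by (intro add_mono emeasure_subadditive_finite) auto
    also have "\<dots> < \<infinity>"
      using A(2) B(2) by (auto simp: less_top)
    finally show ?thesis .
  qed
  have A's: "A' j \<in> sets m" "A' j \<subseteq> U" if "j \<le> Suc k" for j
    using A Us by (auto simp: A'_def U_def)
  have B's: "B' j \<in> sets m" "B' j \<subseteq> U" if "j \<le> Suc l" for j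
    using B Us by (auto simp: B'_def U_def)
  have A'disj: "i = j" if "i \<le> Suc k" "j \<le> Suc k" "s \<in> A' i" "s \<in> A' j" for i j s
    using that simple_repr_disjoint[OF r]
    by (cases "i \<le> k"; cases "j \<le> k") (auto simp: A'_def disjoint_family_on_def)
  have B'disj: "i = j" if "i \<le> Suc l" "j \<le> Suc l" "s \<in> B' i" "s \<in> B' j" for i j s
    using that simple_repr_disjoint[OF r']
    by (cases "i \<le> l"; cases "j \<le> l") (auto simp: B'_def disjoint_family_on_def)
  have A'cover: "\<exists>j\<le>Suc k. s \<in> A' j" if "s \<in> U" for s
  proof (cases "\<exists>j\<le>k. s \<in> A j")
    case True
    then obtain j where "j \<le> k" "s \<in> A j" by blast
    then show ?thesis by (intro exI[of _ j]) (simp add: A'_def)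
  next
    case False
    with that show ?thesis by (intro exI[of _ "Suc k"]) (simp add: A'_def)
  qed
  have B'cover: "\<exists>j\<le>Suc l. s \<in> B' j" if "s \<in> U" for s
  proof (cases "\<exists>j\<le>l. s \<in> B j")
    case True
    then obtain j where "j \<le> l" "s \<in> B j" by blast
    then show ?thesis by (intro exI[of _ j]) (simp add: B'_def)
  next
    case False
    with that show ?thesis by (intro exI[of _ "Suc l"]) (simp add: B'_def)
  qed
  have p: "p s = (if i \<le> k then a i else 0)" if "i \<le> Suc k" "s \<in> A' i" for i s
    using that Uspace simple_repr_on[OF r, of i s] simple_repr_off[OF r, of s]
    by (auto simp: A'_def)
  have q: "q s = (if i \<le> l then b i else 0)" if "i \<le> Suc l" "s \<in> B' i" for i s
    using that Uspace simple_repr_on[OF r', of i s] simple_repr_off[OF r', of s]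
    by (auto simp: B'_def)
  have parts: "finite I" "\<forall>i\<in>I. C i \<in> finite_sets m" "disjoint_family_on C I"
  proof (goal_cases)
    case 1
    show ?case by (simp add: I_def)
  next
    case 2
    have "C i \<in> finite_sets m" if "i \<in> I" for i
    proof -
      obtain i1 i2 where i: "i = (i1, i2)" "i1 \<le> Suc k" "i2 \<le> Suc l"
        using \<open>i \<in> I\<close> by (cases i) (auto simp: I_def)
      have "emeasure m (C i) \<le> emeasure m U"
        using A's[OF i(2)] Us by (intro emeasure_mono) (auto simp: C_def i)
      then show ?thesis
        using A's[OF i(2)] B's[OF i(3)] Um by (auto simp: finite_sets_def C_def i)
    qed
    then show ?case by blast
  next
    case 3
    show ?case
      using A'disj B'disj by (fastforce simp: disjoint_family_on_def I_def C_def)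
  qed
  have off: "p s = 0 \<and> q s = 0" if s: "s \<in> space m" and off: "\<forall>i\<in>I. s \<notin> C i" for s
  proof -
    have "s \<notin> U"
    proof
      assume "s \<in> U"
      then obtain i j where "i \<le> Suc k" "s \<in> A' i" "j \<le> Suc l" "s \<in> B' j"
        using A'cover B'cover by blast
      then show False using off[rule_format, of "(i, j)"] by (auto simp: I_def C_def)
    qed
    then show ?thesis
      using simple_repr_off[OF r s] simple_repr_off[OF r' s] by (auto simp: U_def)
  qed
  show ?thesis
  proof (intro exI conjI)
    show "step_on m I C u p"
      unfolding step_on_def using parts off p simple_repr_coeff[OF r]
      by (auto simp: I_def C_def u_def)
    show "step_on m I C v q"
      unfolding step_on_def using parts off q simple_repr_coeff[OF r']
      by (auto simp: I_def C_def v_def)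
    have "A j = (\<Union>i\<in>{i \<in> I. fst i = j}. C i)" if "j \<le> k" for j
    proof (intro equalityI subsetI)
      fix s assume s: "s \<in> A j"
      then have "s \<in> U" using that by (auto simp: U_def)
      then obtain i where i: "i \<le> Suc l" "s \<in> B' i" using B'cover by blast
      have "(j, i) \<in> {i \<in> I. fst i = j}" "s \<in> C (j, i)"
        using i s that by (auto simp: I_def C_def A'_def)
      then show "s \<in> (\<Union>i\<in>{i \<in> I. fst i = j}. C i)" by blast
    qed (use that in \<open>auto simp: C_def A'_def\<close>)
    then show "refines I C u fst (k, a, A)"
      by (auto simp: refines_def u_def)
    have "B j = (\<Union>i\<in>{i \<in> I. snd i = j}. C i)" if "j \<le> l" for j
    proof (intro equalityI subsetI)
      fix s assume s: "s \<in> B j"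
      then have "s \<in> U" using that by (auto simp: U_def)
      then obtain i where i: "i \<le> Suc k" "s \<in> A' i" using A'cover by blast
      have "(i, j) \<in> {i \<in> I. snd i = j}" "s \<in> C (i, j)"
        using i s that by (auto simp: I_def C_def B'_def)
      then show "s \<in> (\<Union>i\<in>{i \<in> I. snd i = j}. C i)" by blast
    qed (use that in \<open>auto simp: C_def B'_def\<close>)
    then show "refines I C v snd (l, b, B)"
      by (auto simp: refines_def v_def)
  qed
qed

section \<open>The integral of one simple function\<close>

context sup_measure
begin

lemma repr_integral_measurable:
  assumes r: "simple_repr m g r"
  shows "repr_integral f M r \<in> borel_measurable P"
proof -
  obtain k a A where [simp]: "r = (k, a, A)" by (cases r)
  have "(\<lambda>\<omega>. fmax_upto f (\<lambda>j. a j *\<^sub>R M (A j) \<omega>) k) \<in> borel_measurable P"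
    using r M_measurable by (intro fmax_upto_measurable[OF loss] borel_measurable_scaleR)
      (auto simp: simple_repr_def)
  then show ?thesis by (simp add: repr_integral_def)
qed

text \<open>The loss of the integral is the maximum of independent Frechet variables with scales
  \<open>a j * m (A j) powr (1 / \<alpha>)\<close>; hence it is Frechet, and its scale is the \<open>\<alpha>\<close>-norm of \<open>g\<close>.\<close>

lemma loss_repr_integral_le:
  assumes r: "simple_repr m g r" and L: "(\<integral>\<^sup>+s. ennreal (g s powr \<alpha>) \<partial>m) = ennreal L" "0 \<le> L"
    and x: "0 < x"
  shows "prob {\<omega> \<in> space P. f (repr_integral f M r \<omega>) \<le> x} = exp (- (L * x powr (- \<alpha>)))"
proof -
  obtain k a A where r_eq: "r = (k, a, A)" by (cases r)
  note r = r[unfolded r_eq]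
  have "ennreal L = ennreal (\<Sum>j\<le>k. a j powr \<alpha> * measure m (A j))"
    unfolding L(1)[symmetric]
    by (rule step_nn_integral_powr[OF simple_repr_step_on[OF r]])
  then have L_eq: "L = (\<Sum>j\<le>k. a j powr \<alpha> * measure m (A j))"
    using L(2) by (subst (asm) ennreal_inj) (auto intro: sum_nonneg)
  have ind: "indep_vars (\<lambda>_. borel) (\<lambda>j \<omega>. a j * f (M (A j) \<omega>)) {..k}"
    by (rule indep_vars_compose2[OF M_indep_vars])
      (use simple_repr_sets[OF r] simple_repr_disjoint[OF r] in auto)
  have "{\<omega> \<in> space P. f (repr_integral f M r \<omega>) \<le> x} =
      {\<omega> \<in> space P. \<forall>j\<in>{..k}. a j * f (M (A j) \<omega>) \<le> x}"
    using simple_repr_coeff[OF r]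
    by (auto simp: repr_integral_def r_eq loss_fmax_upto_le_iff loss_function_scaleR[OF loss])
  also have "prob \<dots> = exp (- (L * x powr (- \<alpha>)))"
    unfolding L_eq using simple_reprD(1,2)[OF r]
    by (intro frechet_rv_family_prob(1)[OF _ ind _ x] frechet_rv_scale loss_M_frechet_rv) auto
  finally show ?thesis .
qed

text \<open>If one part \<open>i0\<close> of a refinement strictly wins, it decides the value of the integral, whatever
  representation is used: the set \<open>A j\<close> that contains the part inherits its vector, and every other
  \<open>A j\<close> carries the vector of a losing part.\<close>

lemma repr_integral_strict_maximum:
  assumes I: "finite I" and C: "\<And>i. i \<in> I \<Longrightarrow> C i \<in> finite_sets m" and disj: "disjoint_family_on C I"
    and ref: "refines I C u h r" and r: "simple_repr m g r"
  shows "AE \<omega> in P. \<forall>i0\<in>I. 0 < u i0 * f (M (C i0) \<omega>) \<longrightarrow>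
    (\<forall>i\<in>I - {i0}. u i * f (M (C i) \<omega>) < u i0 * f (M (C i0) \<omega>)) \<longrightarrow>
    repr_integral f M r \<omega> = u i0 *\<^sub>R M (C i0) \<omega>"
proof -
  obtain k a A where r_eq: "r = (k, a, A)" by (cases r)
  note r = r[unfolded r_eq] and ref = ref[unfolded r_eq]
  let ?J = "\<lambda>j. {i \<in> I. h i = j}"
  have A: "A j = (\<Union>i\<in>?J j. C i)" if "j \<le> k" for j
    using ref that by (simp add: refines_def)
  have u: "u i = (if h i \<le> k then a (h i) else 0)" if "i \<in> I" for i
    using ref that by (simp add: refines_def)
  note a = simple_repr_coeff[OF r]
  have "AE \<omega> in P. \<forall>j. (\<forall>i\<in>?J j. f (M (C i) \<omega>) \<le> f (M (\<Union>i\<in>?J j. C i) \<omega>)) \<and>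
      (M (\<Union>i\<in>?J j. C i) \<omega> = 0 \<or> (\<exists>i\<in>?J j. M (\<Union>i\<in>?J j. C i) \<omega> = M (C i) \<omega>))"
    unfolding AE_all_countable
  proof
    fix j
    show "AE \<omega> in P. (\<forall>i\<in>?J j. f (M (C i) \<omega>) \<le> f (M (\<Union>i\<in>?J j. C i) \<omega>)) \<and>
      (M (\<Union>i\<in>?J j. C i) \<omega> = 0 \<or> (\<exists>i\<in>?J j. M (\<Union>i\<in>?J j. C i) \<omega> = M (C i) \<omega>))"
      by (rule M_finite_Union) (use I C disj in \<open>auto simp: disjoint_family_on_def\<close>)
  qed
  then show ?thesis
  proof eventually_elim
    case (elim \<omega>)
    have le: "f (M (C i) \<omega>) \<le> f (M (A (h i)) \<omega>)" if "i \<in> I" "h i \<le> k" for i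
      using elim[rule_format, of "h i"] that A[of "h i"] by auto
    have mem: "M (A j) \<omega> = 0 \<or> (\<exists>i\<in>I. h i = j \<and> M (A j) \<omega> = M (C i) \<omega>)" if "j \<le> k" for j
      using elim[rule_format, of j] that A[of j] by auto
    have f0: "f 0 = 0" using loss_function_eq_0_iff[OF loss] by simp
    show ?case
    proof (intro ballI impI)
      fix i0 assume i0: "i0 \<in> I" and pos: "0 < u i0 * f (M (C i0) \<omega>)"
        and win: "\<forall>i\<in>I - {i0}. u i * f (M (C i) \<omega>) < u i0 * f (M (C i0) \<omega>)"
      let ?j = "h i0"
      have j: "?j \<le> k" "u i0 = a ?j"
        using u[OF i0] pos by (auto split: if_splits)
      have *: "a ?j * f (M (C i0) \<omega>) \<le> a ?j * f (M (A ?j) \<omega>)"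
        using le[OF i0 j(1)] a[OF j(1)] by (rule mult_left_mono)
      have MA: "M (A ?j) \<omega> = M (C i0) \<omega>"
        using mem[OF j(1)]
      proof (elim disjE bexE conjE)
        assume "M (A ?j) \<omega> = 0"
        then show ?thesis using * pos j f0 by simp
      next
        fix i assume i: "i \<in> I" "h i = ?j" "M (A ?j) \<omega> = M (C i) \<omega>"
        have "i = i0"
        proof (rule ccontr)
          assume "i \<noteq> i0"
          then have "u i * f (M (C i) \<omega>) < u i0 * f (M (C i0) \<omega>)" using win i by blast
          moreover have "u i = a ?j" using u[OF i(1)] i j by simp
          ultimately show False using * i j by simp
        qed
        then show ?thesis using i by simp
      qed
      have "fmax_upto f (\<lambda>j. a j *\<^sub>R M (A j) \<omega>) k = a ?j *\<^sub>R M (A ?j) \<omega>"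
      proof (rule fmax_upto_strict_maximum[OF j(1)])
        fix j' assume j': "j' \<le> k" "j' \<noteq> ?j"
        have "a j' * f (M (A j') \<omega>) < a ?j * f (M (A ?j) \<omega>)"
          using mem[OF j'(1)]
        proof (elim disjE bexE conjE)
          assume "M (A j') \<omega> = 0"
          then show ?thesis using MA pos j f0 by simp
        next
          fix i assume i: "i \<in> I" "h i = j'" "M (A j') \<omega> = M (C i) \<omega>"
          then have "u i * f (M (C i) \<omega>) < u i0 * f (M (C i0) \<omega>)" using win j' by blast
          moreover have "u i = a j'" using u[OF i(1)] i j' by simp
          ultimately show ?thesis using i j MA by simp
        qed
        then show "f (a j' *\<^sub>R M (A j') \<omega>) < f (a ?j *\<^sub>R M (A ?j) \<omega>)"
          using a j j' by (simp add: loss_function_scaleR[OF loss])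
      qed
      then show "repr_integral f M r \<omega> = u i0 *\<^sub>R M (C i0) \<omega>"
        using MA j by (simp add: repr_integral_def r_eq)
    qed
  qed
qed

end

section \<open>Integrals of two simple functions\<close>

context sup_measure
begin

text \<open>Both functions are written on one partition, with lower coefficients \<open>c = min u v\<close> and upper
  coefficients \<open>d = max u v\<close>. When a part with \<open>c\<close> beats all other parts with \<open>d\<close>, it decides both
  integrals, which are then the multiples \<open>u i\<close> and \<open>v i\<close> of one vector. The set \<open>G\<close> keeps the parts
  where these multiples are close; the parts outside \<open>G\<close> have a small total weight, because there
  \<open>d powr \<alpha> - c powr \<alpha>\<close> is at least a fixed multiple of \<open>c powr \<alpha>\<close>.\<close>

lemma repr_integrals_close_prob:
  assumes r: "simple_repr m p r" and r': "simple_repr m q r'" and \<delta>: "0 < \<delta>" "\<delta> < 1"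
    and L: "(\<integral>\<^sup>+s. ennreal (min (p s) (q s) powr \<alpha>) \<partial>m) = ennreal L" "0 \<le> L"
    and D: "(\<integral>\<^sup>+s. ennreal (max (p s) (q s) powr \<alpha>) \<partial>m) = ennreal D" "0 \<le> D"
  shows "(L - (D - L) / ((1 - \<delta>) powr (- \<alpha>) - 1)) / D \<le>
    prob {\<omega> \<in> space P. dist (repr_integral f M r \<omega>) (repr_integral f M r' \<omega>) \<le>
      \<delta> * max (norm (repr_integral f M r \<omega>)) (norm (repr_integral f M r' \<omega>))}"
proof -
  obtain k a A where r_eq: "r = (k, a, A)" by (cases r)
  obtain l b B where r'_eq: "r' = (l, b, B)" by (cases r')
  obtain I :: "(nat \<times> nat) set" and C u v h h' where
    "step_on m I C u p \<and> step_on m I C v q \<and> refines I C u h (k, a, A) \<and> refines I C v h' (l, b, B)"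
    using common_refinement[OF r[unfolded r_eq] r'[unfolded r'_eq]] by (elim exE) (rule that)
  then have step: "step_on m I C u p" "step_on m I C v q"
    and ref: "refines I C u h r" and ref': "refines I C v h' r'"
    unfolding r_eq r'_eq by blast+
  have I: "finite I" and C: "\<And>i. i \<in> I \<Longrightarrow> C i \<in> finite_sets m" and disj: "disjoint_family_on C I"
    and u: "\<And>i. i \<in> I \<Longrightarrow> 0 \<le> u i" and v: "\<And>i. i \<in> I \<Longrightarrow> 0 \<le> v i"
    using step by (auto simp: step_on_def)
  define c where "c i = min (u i) (v i)" for i
  define d where "d i = max (u i) (v i)" for i
  define w where "w i = measure m (C i)" for i
  define X where "X i = (\<lambda>\<omega>. f (M (C i) \<omega>))" for i
  define G where "G = {i \<in> I. (1 - \<delta>) * d i \<le> c i}"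
  define q\<^sub>0 where "q\<^sub>0 = (1 - \<delta>) powr (- \<alpha>) - 1"
  have cd: "0 \<le> c i" "c i \<le> d i" if "i \<in> I" for i
    using u[OF that] v[OF that] by (auto simp: c_def d_def)
  have w: "0 \<le> w i" for i by (simp add: w_def)
  have q\<^sub>0: "0 < q\<^sub>0"
    using powr_less_mono2_neg[of "- \<alpha>" "1 - \<delta>" 1] \<delta> \<alpha> by (simp add: q\<^sub>0_def)
  have "ennreal L = ennreal (\<Sum>i\<in>I. c i powr \<alpha> * w i)"
    unfolding L(1)[symmetric] w_def
    unfolding c_def by (rule step_nn_integral_powr[OF step_on_combine[OF step]]) auto
  then have L_eq: "L = (\<Sum>i\<in>I. c i powr \<alpha> * w i)"
    using L(2) w by (subst (asm) ennreal_inj) (auto intro: sum_nonneg)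
  have "ennreal D = ennreal (\<Sum>i\<in>I. d i powr \<alpha> * w i)"
    unfolding D(1)[symmetric] w_def
    unfolding d_def by (rule step_nn_integral_powr[OF step_on_combine[OF step]]) auto
  then have D_eq: "D = (\<Sum>i\<in>I. d i powr \<alpha> * w i)"
    using D(2) w by (subst (asm) ennreal_inj) (auto intro: sum_nonneg)
  have weight: "(\<Sum>i\<in>I - G. c i powr \<alpha> * w i) * q\<^sub>0 \<le> D - L"
  proof -
    have "(\<Sum>i\<in>I - G. c i powr \<alpha> * w i) * q\<^sub>0 \<le> (\<Sum>i\<in>I - G. d i powr \<alpha> * w i - c i powr \<alpha> * w i)"
      unfolding sum_distrib_right
    proof (rule sum_mono)
      fix i assume "i \<in> I - G"
      then have i: "i \<in> I" "c i < (1 - \<delta>) * d i" by (auto simp: G_def)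
      have "c i powr \<alpha> * (1 - \<delta>) powr (- \<alpha>) = (c i / (1 - \<delta>)) powr \<alpha>"
        using cd[OF i(1)] \<delta> by (simp add: powr_divide powr_minus field_simps)
      also have "\<dots> \<le> d i powr \<alpha>"
        using cd[OF i(1)] i(2) \<delta> \<alpha> by (intro powr_mono2) (auto simp: field_simps)
      finally have "c i powr \<alpha> * (1 - \<delta>) powr (- \<alpha>) * w i \<le> d i powr \<alpha> * w i"
        using w by (rule mult_right_mono)
      then show "c i powr \<alpha> * w i * q\<^sub>0 \<le> d i powr \<alpha> * w i - c i powr \<alpha> * w i"
        by (simp add: q\<^sub>0_def algebra_simps)
    qed
    also have "\<dots> \<le> (\<Sum>i\<in>I. d i powr \<alpha> * w i - c i powr \<alpha> * w i)"
      using I cd w \<alpha> by (intro sum_mono2) (auto intro!: mult_right_mono powr_mono2)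
    finally show ?thesis by (simp add: L_eq D_eq sum_subtractf)
  qed
  have "(L - (D - L) / q\<^sub>0) \<le> (\<Sum>i\<in>G. c i powr \<alpha> * w i)"
  proof -
    have "L = (\<Sum>i\<in>I - G. c i powr \<alpha> * w i) + (\<Sum>i\<in>G. c i powr \<alpha> * w i)"
      unfolding L_eq by (rule sum.subset_diff[OF _ I]) (auto simp: G_def)
    moreover have "(\<Sum>i\<in>I - G. c i powr \<alpha> * w i) \<le> (D - L) / q\<^sub>0"
      using weight q\<^sub>0 by (simp add: field_simps)
    ultimately show ?thesis by linarith
  qed
  then have "(L - (D - L) / q\<^sub>0) / D \<le> (\<Sum>i\<in>G. c i powr \<alpha> * w i) / D"
    using D(2) by (rule divide_right_mono)
  also have "\<dots> \<le> prob {\<omega> \<in> space P. \<exists>j\<in>G. 0 < c j * X j \<omega> \<and> (\<forall>k\<in>I - {j}. d k * X k \<omega> < c j * X j \<omega>)}"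
    unfolding D_eq
  proof (rule frechet_dominance_prob[OF I])
    show "G \<subseteq> I" by (auto simp: G_def)
    show "indep_vars (\<lambda>_. borel) X I"
      unfolding X_def by (rule M_indep_vars[OF I C disj])
    show "frechet_rv P \<alpha> (w i) (X i)" if "i \<in> I" for i
      unfolding X_def w_def by (rule loss_M_frechet_rv[OF C[OF that]])
  qed (use cd w \<alpha> in auto)
  also have "\<dots> \<le> prob {\<omega> \<in> space P. dist (repr_integral f M r \<omega>) (repr_integral f M r' \<omega>) \<le>
      \<delta> * max (norm (repr_integral f M r \<omega>)) (norm (repr_integral f M r' \<omega>))}"
  proof (rule finite_measure_mono_AE)
    note [measurable] = repr_integral_measurable[OF r] repr_integral_measurable[OF r']
    show "{\<omega> \<in> space P. dist (repr_integral f M r \<omega>) (repr_integral f M r' \<omega>) \<le>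
      \<delta> * max (norm (repr_integral f M r \<omega>)) (norm (repr_integral f M r' \<omega>))} \<in> events"
      by measurable
    have win_p: "AE \<omega> in P. \<forall>i0\<in>I. 0 < u i0 * f (M (C i0) \<omega>) \<longrightarrow>
        (\<forall>i\<in>I - {i0}. u i * f (M (C i) \<omega>) < u i0 * f (M (C i0) \<omega>)) \<longrightarrow>
        repr_integral f M r \<omega> = u i0 *\<^sub>R M (C i0) \<omega>"
      by (rule repr_integral_strict_maximum[OF I _ disj ref r]) (rule C)
    have win_q: "AE \<omega> in P. \<forall>i0\<in>I. 0 < v i0 * f (M (C i0) \<omega>) \<longrightarrow>
        (\<forall>i\<in>I - {i0}. v i * f (M (C i) \<omega>) < v i0 * f (M (C i0) \<omega>)) \<longrightarrow>
        repr_integral f M r' \<omega> = v i0 *\<^sub>R M (C i0) \<omega>"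
      by (rule repr_integral_strict_maximum[OF I _ disj ref' r']) (rule C)
    show "AE \<omega> in P. \<omega> \<in> {\<omega> \<in> space P. \<exists>j\<in>G. 0 < c j * X j \<omega> \<and> (\<forall>k\<in>I - {j}. d k * X k \<omega> < c j * X j \<omega>)} \<longrightarrow>
      \<omega> \<in> {\<omega> \<in> space P. dist (repr_integral f M r \<omega>) (repr_integral f M r' \<omega>) \<le>
        \<delta> * max (norm (repr_integral f M r \<omega>)) (norm (repr_integral f M r' \<omega>))}"
      using win_p win_q
    proof eventually_elim
      case (elim \<omega>)
      show ?case
      proof (intro impI)
        assume "\<omega> \<in> {\<omega> \<in> space P. \<exists>j\<in>G. 0 < c j * X j \<omega> \<and> (\<forall>k\<in>I - {j}. d k * X k \<omega> < c j * X j \<omega>)}"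
        then obtain j where \<omega>: "\<omega> \<in> space P" and j: "j \<in> G" and pos: "0 < c j * X j \<omega>"
          and win: "\<And>k. k \<in> I - {j} \<Longrightarrow> d k * X k \<omega> < c j * X j \<omega>" by auto
        have jI: "j \<in> I" using j by (simp add: G_def)
        have X: "0 \<le> X i \<omega>" for i
          by (simp add: X_def loss_function_nonneg[OF loss])
        have between: "c i * X i \<omega> \<le> u i * X i \<omega>" "u i * X i \<omega> \<le> d i * X i \<omega>"
            "c i * X i \<omega> \<le> v i * X i \<omega>" "v i * X i \<omega> \<le> d i * X i \<omega>" for i
          using X[of i] by (auto simp: c_def d_def intro!: mult_right_mono)
        have eq_p: "repr_integral f M r \<omega> = u j *\<^sub>R M (C j) \<omega>"
        proof (rule elim(1)[rule_format, OF jI])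
          show "0 < u j * f (M (C j) \<omega>)" using pos between(1)[of j] by (simp add: X_def)
          show "u i * f (M (C i) \<omega>) < u j * f (M (C j) \<omega>)" if "i \<in> I - {j}" for i
            using win[OF that] between(1)[of j] between(2)[of i] by (simp add: X_def)
        qed
        have eq_q: "repr_integral f M r' \<omega> = v j *\<^sub>R M (C j) \<omega>"
        proof (rule elim(2)[rule_format, OF jI])
          show "0 < v j * f (M (C j) \<omega>)" using pos between(3)[of j] by (simp add: X_def)
          show "v i * f (M (C i) \<omega>) < v j * f (M (C j) \<omega>)" if "i \<in> I - {j}" for i
            using win[OF that] between(3)[of j] between(4)[of i] by (simp add: X_def)
        qed
        have "dist (u j *\<^sub>R M (C j) \<omega>) (v j *\<^sub>R M (C j) \<omega>) = (d j - c j) * norm (M (C j) \<omega>)"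
          by (simp add: dist_norm flip: scaleR_left_diff_distrib) (simp add: c_def d_def abs_if)
        also have "\<dots> \<le> (\<delta> * d j) * norm (M (C j) \<omega>)"
          using j by (intro mult_right_mono) (auto simp: G_def algebra_simps)
        also have "\<dots> = \<delta> * max (norm (u j *\<^sub>R M (C j) \<omega>)) (norm (v j *\<^sub>R M (C j) \<omega>))"
          using u[OF jI] v[OF jI] by (simp add: d_def max_mult_distrib_right mult.assoc)
        finally show "\<omega> \<in> {\<omega> \<in> space P. dist (repr_integral f M r \<omega>) (repr_integral f M r' \<omega>) \<le>
          \<delta> * max (norm (repr_integral f M r \<omega>)) (norm (repr_integral f M r' \<omega>))}"
          using \<omega> by (simp add: eq_p eq_q)
      qed
    qed
  qed
  finally show ?thesis by (simp add: q\<^sub>0_def)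
qed

lemma repr_of_simple_fun: "simple_fun m g \<Longrightarrow> simple_repr m g (SOME r. simple_repr m g r)"
  unfolding simple_fun_def by (rule someI_ex)

lemma sup_integral_measurable: "simple_fun m g \<Longrightarrow> sup_integral f m M g \<in> borel_measurable P"
  unfolding sup_integral_def by (rule repr_integral_measurable[OF repr_of_simple_fun])

text \<open>Through \<open>norm x \<le> c * f x\<close> the Frechet law of the loss bounds the tail of the integral,
  uniformly over all simple functions of bounded \<open>\<alpha>\<close>-norm.\<close>

lemma sup_integral_norm_tail:
  assumes c: "0 < c" "\<And>x. norm x \<le> c * f x"
    and p: "simple_fun m p" and le: "(\<integral>\<^sup>+s. ennreal (p s powr \<alpha>) \<partial>m) \<le> ennreal \<Gamma>"
    and \<Gamma>: "0 \<le> \<Gamma>" and R: "0 < (R::real)"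
  shows "prob {\<omega> \<in> space P. R < norm (sup_integral f m M p \<omega>)} \<le> 1 - exp (- (\<Gamma> * (R / c) powr (- \<alpha>)))"
proof -
  have x: "0 < R / c" using c R by simp
  define L where "L = enn2real (\<integral>\<^sup>+s. ennreal (p s powr \<alpha>) \<partial>m)"
  have "(\<integral>\<^sup>+s. ennreal (p s powr \<alpha>) \<partial>m) < top"
    using le by (rule order.strict_trans1) simp
  then have L: "(\<integral>\<^sup>+s. ennreal (p s powr \<alpha>) \<partial>m) = ennreal L" "0 \<le> L"
    by (simp_all add: L_def)
  have L\<Gamma>: "L \<le> \<Gamma>" using le L \<Gamma> by simp
  note [measurable] = sup_integral_measurable[OF p] loss_function_measurable[OF loss]
  have "R / c < f (sup_integral f m M p \<omega>)" if "R < norm (sup_integral f m M p \<omega>)" for \<omega>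
    using order.strict_trans2[OF that c(2)] c(1) by (simp add: field_simps)
  then have "prob {\<omega> \<in> space P. R < norm (sup_integral f m M p \<omega>)} \<le>
      prob (space P - {\<omega> \<in> space P. f (sup_integral f m M p \<omega>) \<le> R / c})"
    by (intro finite_measure_mono) (fastforce, measurable)
  also have "\<dots> = 1 - exp (- (L * (R / c) powr (- \<alpha>)))"
    using loss_repr_integral_le[OF repr_of_simple_fun[OF p] L x]
    by (subst prob_compl) (auto simp: sup_integral_def[symmetric])
  also have "\<dots> \<le> 1 - exp (- (\<Gamma> * (R / c) powr (- \<alpha>)))"
    using L\<Gamma> by (simp add: mult_right_mono)
  finally show ?thesis .
qed

text \<open>The modulus \<open>\<eta>\<close> depends on \<open>p\<close> and \<open>q\<close> only through the bound \<open>\<Gamma>\<close> on the integral of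
  \<open>max p q powr \<alpha>\<close>; this uniformity is what turns closeness of norms into a Cauchy property.\<close>

lemma sup_integrals_close:
  assumes \<Gamma>: "0 \<le> \<Gamma>" and \<epsilon>: "0 < \<epsilon>" and \<theta>: "0 < \<theta>"
  shows "\<exists>\<eta>>0. \<forall>p q. simple_fun m p \<longrightarrow> simple_fun m q \<longrightarrow>
    (\<integral>\<^sup>+s. ennreal (max (p s) (q s) powr \<alpha>) \<partial>m) \<le> ennreal \<Gamma> \<longrightarrow>
    ennreal (\<Gamma> - \<eta>) \<le> (\<integral>\<^sup>+s. ennreal (min (p s) (q s) powr \<alpha>) \<partial>m) \<longrightarrow>
    prob {\<omega> \<in> space P. \<epsilon> < dist (sup_integral f m M p \<omega>) (sup_integral f m M q \<omega>)} < \<theta>"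
proof -
  obtain c where c: "0 < c" "\<And>x. norm x \<le> c * f x"
    using loss_function_norm_bound[OF loss] by blast
  note tail = sup_integral_norm_tail[OF c _ _ \<Gamma>]
  obtain R where R: "0 < R" "1 - exp (- (\<Gamma> * (R / c) powr (- \<alpha>))) < \<theta> / 3"
  proof -
    have "((\<lambda>x. 1 - exp (- (\<Gamma> * (x / c) powr (- \<alpha>)))) \<longlongrightarrow> 0) at_top"
      using \<alpha> c by real_asymp
    then have "eventually (\<lambda>x. 1 - exp (- (\<Gamma> * (x / c) powr (- \<alpha>))) < \<theta> / 3) at_top"
      using \<theta> by (intro order_tendstoD) auto
    from eventually_happens[OF eventually_conj[OF this eventually_gt_at_top[of 0]]]
    show ?thesis using that by auto
  qed
  \<comment> \<open>Relative closeness \<open>\<delta>\<close> means absolute closeness \<open>\<epsilon>\<close> as long as the norms stay below \<open>R\<close>.\<close>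
  define \<delta> where "\<delta> = min (1/2) (\<epsilon> / R)"
  have \<delta>: "0 < \<delta>" "\<delta> < 1" "\<delta> * R \<le> \<epsilon>"
    using \<epsilon> R(1) by (auto simp: \<delta>_def min_def field_simps)
  define q\<^sub>0 where "q\<^sub>0 = (1 - \<delta>) powr (- \<alpha>) - 1"
  have q\<^sub>0: "0 < q\<^sub>0"
    using powr_less_mono2_neg[of "- \<alpha>" "1 - \<delta>" 1] \<delta> \<alpha> by (simp add: q\<^sub>0_def)
  \<comment> \<open>For \<open>\<Gamma> = 0\<close> both integrals vanish almost surely, and any \<open>\<eta>\<close> will do. Otherwise
    \<open>\<eta> \<le> \<Gamma> / 2\<close> keeps the denominator \<open>D\<close> above \<open>\<Gamma> / 2\<close>, and the constant \<open>7\<close>, which exceeds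
    \<open>2 * 3\<close>, leaves less than \<open>\<theta> / 3\<close> for the event that no part decides both integrals.\<close>
  define \<eta> where "\<eta> = (if \<Gamma> = 0 then 1 else min (\<Gamma> / 2) (\<theta> * \<Gamma> / (7 * (1 + 1 / q\<^sub>0))))"
  have \<eta>: "0 < \<eta>" using \<Gamma> \<theta> q\<^sub>0 by (auto simp: \<eta>_def intro!: divide_pos_pos add_pos_pos)
  show ?thesis
  proof (intro exI conjI allI impI)
    show "0 < \<eta>" by (rule \<eta>)
    fix p q assume p: "simple_fun m p" and q: "simple_fun m q"
      and max_le: "(\<integral>\<^sup>+s. ennreal (max (p s) (q s) powr \<alpha>) \<partial>m) \<le> ennreal \<Gamma>"
      and min_ge: "ennreal (\<Gamma> - \<eta>) \<le> (\<integral>\<^sup>+s. ennreal (min (p s) (q s) powr \<alpha>) \<partial>m)"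
    let ?Ip = "sup_integral f m M p" and ?Iq = "sup_integral f m M q"
    note [measurable] = sup_integral_measurable[OF p] sup_integral_measurable[OF q]
    have mono: "(\<integral>\<^sup>+s. ennreal (g s powr \<alpha>) \<partial>m) \<le> (\<integral>\<^sup>+s. ennreal (max (p s) (q s) powr \<alpha>) \<partial>m)"
      if "\<And>s. s \<in> space m \<Longrightarrow> 0 \<le> g s" "\<And>s. s \<in> space m \<Longrightarrow> g s \<le> max (p s) (q s)" for g
      using that \<alpha> by (intro nn_integral_mono ennreal_leI powr_mono2) auto
    note nonneg = simple_fun_nonneg[OF p] simple_fun_nonneg[OF q]
    have p\<Gamma>: "(\<integral>\<^sup>+s. ennreal (p s powr \<alpha>) \<partial>m) \<le> ennreal \<Gamma>"
      using nonneg by (intro order_trans[OF mono max_le]) auto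
    have q\<Gamma>: "(\<integral>\<^sup>+s. ennreal (q s powr \<alpha>) \<partial>m) \<le> ennreal \<Gamma>"
      using nonneg by (intro order_trans[OF mono max_le]) auto
    have pR: "prob {\<omega> \<in> space P. R < norm (?Ip \<omega>)} < \<theta> / 3"
      using tail[OF p p\<Gamma> R(1)] R(2) by linarith
    have qR: "prob {\<omega> \<in> space P. R < norm (?Iq \<omega>)} < \<theta> / 3"
      using tail[OF q q\<Gamma> R(1)] R(2) by linarith
    show "prob {\<omega> \<in> space P. \<epsilon> < dist (?Ip \<omega>) (?Iq \<omega>)} < \<theta>"
    proof (cases "\<Gamma> = 0")
      case True
      have "\<epsilon> / 2 < norm (?Ip \<omega>) \<or> \<epsilon> / 2 < norm (?Iq \<omega>)" if "\<epsilon> < dist (?Ip \<omega>) (?Iq \<omega>)" for \<omega>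
        using that norm_triangle_ineq4[of "?Ip \<omega>" "?Iq \<omega>"] by (auto simp: dist_norm)
      then have "prob {\<omega> \<in> space P. \<epsilon> < dist (?Ip \<omega>) (?Iq \<omega>)} \<le>
          prob ({\<omega> \<in> space P. \<epsilon> / 2 < norm (?Ip \<omega>)} \<union> {\<omega> \<in> space P. \<epsilon> / 2 < norm (?Iq \<omega>)})"
        by (intro finite_measure_mono) (blast, measurable)
      also have "\<dots> \<le> prob {\<omega> \<in> space P. \<epsilon> / 2 < norm (?Ip \<omega>)} + prob {\<omega> \<in> space P. \<epsilon> / 2 < norm (?Iq \<omega>)}"
        by (rule measure_Un_le) measurable
      finally show ?thesis
        using tail[OF p p\<Gamma>, of "\<epsilon> / 2"] tail[OF q q\<Gamma>, of "\<epsilon> / 2"] \<epsilon> \<theta> True by simp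
    next
      case False
      define D where "D = enn2real (\<integral>\<^sup>+s. ennreal (max (p s) (q s) powr \<alpha>) \<partial>m)"
      define L where "L = enn2real (\<integral>\<^sup>+s. ennreal (min (p s) (q s) powr \<alpha>) \<partial>m)"
      have D_fin: "(\<integral>\<^sup>+s. ennreal (max (p s) (q s) powr \<alpha>) \<partial>m) < top"
        using max_le by (rule order.strict_trans1) simp
      then have D: "(\<integral>\<^sup>+s. ennreal (max (p s) (q s) powr \<alpha>) \<partial>m) = ennreal D" "0 \<le> D"
        by (simp_all add: D_def)
      have min_max: "(\<integral>\<^sup>+s. ennreal (min (p s) (q s) powr \<alpha>) \<partial>m) \<le> (\<integral>\<^sup>+s. ennreal (max (p s) (q s) powr \<alpha>) \<partial>m)"
        using nonneg by (intro mono) auto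
      then have L: "(\<integral>\<^sup>+s. ennreal (min (p s) (q s) powr \<alpha>) \<partial>m) = ennreal L" "0 \<le> L"
        using order.strict_trans1[OF min_max D_fin] by (simp_all add: L_def)
      have \<eta>_le: "\<eta> \<le> \<Gamma> / 2" "\<eta> \<le> \<theta> * \<Gamma> / (7 * (1 + 1 / q\<^sub>0))"
        unfolding \<eta>_def if_not_P[OF False] by (rule min.cobounded1, rule min.cobounded2)
      have LD: "L \<le> D" "D \<le> \<Gamma>" "\<Gamma> - \<eta> \<le> L"
        using min_max max_le min_ge D L \<Gamma> by (auto simp: ennreal_le_iff2)
      have \<Gamma>pos: "0 < \<Gamma>" using \<Gamma> False by simp
      have Dpos: "\<Gamma> / 2 \<le> D" using LD \<eta>_le by linarith
      let ?B = "{\<omega> \<in> space P. dist (?Ip \<omega>) (?Iq \<omega>) \<le> \<delta> * max (norm (?Ip \<omega>)) (norm (?Iq \<omega>))}"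
      have "(L - (D - L) / q\<^sub>0) / D \<le> prob ?B"
        unfolding q\<^sub>0_def sup_integral_def
        by (rule repr_integrals_close_prob[OF repr_of_simple_fun[OF p] repr_of_simple_fun[OF q] \<delta>(1,2) L D])
      moreover have "1 - (L - (D - L) / q\<^sub>0) / D = (D - L) * (1 + 1 / q\<^sub>0) / D"
        using Dpos \<Gamma>pos by (simp add: field_simps)
      moreover have "(D - L) * (1 + 1 / q\<^sub>0) / D < \<theta> / 3"
      proof -
        have "(D - L) * (1 + 1 / q\<^sub>0) / D \<le> \<eta> * (1 + 1 / q\<^sub>0) / (\<Gamma> / 2)"
          using LD Dpos \<Gamma>pos q\<^sub>0 \<eta> by (intro frac_le mult_right_mono) auto
        also have "\<dots> \<le> (\<theta> * \<Gamma> / 7) / (\<Gamma> / 2)"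
        proof (rule divide_right_mono)
          have "0 < 1 + 1 / q\<^sub>0" using q\<^sub>0 by (intro add_pos_pos) auto
          then show "\<eta> * (1 + 1 / q\<^sub>0) \<le> \<theta> * \<Gamma> / 7"
            using \<eta>_le(2) by (simp add: field_simps)
        qed (use \<Gamma>pos in simp)
        also have "\<dots> < \<theta> / 3" using \<Gamma>pos \<theta> by (simp add: field_simps)
        finally show ?thesis .
      qed
      moreover have "prob (space P - ?B) = 1 - prob ?B"
        by (rule prob_compl) measurable
      ultimately have B: "prob (space P - ?B) < \<theta> / 3"
        by linarith
      have "prob {\<omega> \<in> space P. \<epsilon> < dist (?Ip \<omega>) (?Iq \<omega>)} \<le>
          prob ((space P - ?B) \<union> {\<omega> \<in> space P. R < norm (?Ip \<omega>)} \<union> {\<omega> \<in> space P. R < norm (?Iq \<omega>)})"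
      proof (rule finite_measure_mono)
        show "{\<omega> \<in> space P. \<epsilon> < dist (?Ip \<omega>) (?Iq \<omega>)} \<subseteq>
            (space P - ?B) \<union> {\<omega> \<in> space P. R < norm (?Ip \<omega>)} \<union> {\<omega> \<in> space P. R < norm (?Iq \<omega>)}"
        proof (rule subsetI, rule ccontr)
          fix \<omega> assume "\<omega> \<in> {\<omega> \<in> space P. \<epsilon> < dist (?Ip \<omega>) (?Iq \<omega>)}"
            and "\<omega> \<notin> (space P - ?B) \<union> {\<omega> \<in> space P. R < norm (?Ip \<omega>)} \<union> {\<omega> \<in> space P. R < norm (?Iq \<omega>)}"
          then have far: "\<epsilon> < dist (?Ip \<omega>) (?Iq \<omega>)"
            and close: "dist (?Ip \<omega>) (?Iq \<omega>) \<le> \<delta> * max (norm (?Ip \<omega>)) (norm (?Iq \<omega>))"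
            and R': "norm (?Ip \<omega>) \<le> R" "norm (?Iq \<omega>) \<le> R"
            by (simp_all add: not_less)
          have "\<delta> * max (norm (?Ip \<omega>)) (norm (?Iq \<omega>)) \<le> \<delta> * R"
            using R' \<delta>(1) by (intro mult_left_mono) auto
          then show False using far close \<delta>(3) by linarith
        qed
      qed measurable
      also have "\<dots> \<le> prob ((space P - ?B) \<union> {\<omega> \<in> space P. R < norm (?Ip \<omega>)}) + prob {\<omega> \<in> space P. R < norm (?Iq \<omega>)}"
        by (rule measure_Un_le) measurable
      also have "prob ((space P - ?B) \<union> {\<omega> \<in> space P. R < norm (?Ip \<omega>)}) \<le>
          prob (space P - ?B) + prob {\<omega> \<in> space P. R < norm (?Ip \<omega>)}"
        by (rule measure_Un_le) measurable
      finally show ?thesis using B pR qR by linarith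
    qed
  qed
qed

end

section \<open>Monotone approximation by simple functions\<close>

lemma nn_integral_powr_tendsto:
  assumes h: "\<And>n. h n \<in> borel_measurable m" and pos: "\<And>n s. s \<in> space m \<Longrightarrow> 0 \<le> h n s"
    and inc: "\<And>n s. s \<in> space m \<Longrightarrow> h n s \<le> h (Suc n) s"
    and lim: "\<And>s. s \<in> space m \<Longrightarrow> (\<lambda>n. h n s) \<longlonglongrightarrow> g s" and \<alpha>: "0 < \<alpha>"
  shows "(\<lambda>n. \<integral>\<^sup>+s. ennreal (h n s powr \<alpha>) \<partial>m) \<longlonglongrightarrow> (\<integral>\<^sup>+s. ennreal (g s powr \<alpha>) \<partial>m)"
proof -
  note [measurable] = h
  have restrict: "(\<integral>\<^sup>+s. ennreal (g s powr \<alpha>) \<partial>m) = (\<integral>\<^sup>+s. ennreal (g s powr \<alpha>) * indicator (space m) s \<partial>m)" for g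
    by (intro nn_integral_cong) simp
  show ?thesis
    unfolding restrict
  proof (rule nn_integral_LIMSEQ)
    show "incseq (\<lambda>n s. ennreal (h n s powr \<alpha>) * indicator (space m) s)"
      using pos inc \<alpha>
      by (auto simp: incseq_Suc_iff le_fun_def indicator_def intro!: ennreal_leI powr_mono2)
    show "(\<lambda>s. ennreal (h n s powr \<alpha>) * indicator (space m) s) \<in> borel_measurable m" for n
      by measurable
    show "(\<lambda>n. ennreal (h n s powr \<alpha>) * indicator (space m) s) \<longlonglongrightarrow> ennreal (g s powr \<alpha>) * indicator (space m) s" for s
    proof (cases "s \<in> space m")
      case True
      have "(\<lambda>n. h n s powr \<alpha>) \<longlonglongrightarrow> g s powr \<alpha>"
        using lim[OF True] pos[OF True] \<alpha> by (intro tendsto_powr2) auto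
      then show ?thesis using True by simp
    qed simp
  qed
qed

lemma simple_approx_le:
  assumes "simple_approx m gs g" "s \<in> space m"
  shows "gs n s \<le> g s"
proof -
  have "incseq (\<lambda>n. gs n s)" "(\<lambda>n. gs n s) \<longlonglongrightarrow> g s"
    using assms by (auto simp: simple_approx_def incseq_Suc_iff)
  then show ?thesis by (rule incseq_le)
qed

lemma simple_approx_mono:
  assumes "simple_approx m gs g" "s \<in> space m" "n \<le> n'"
  shows "gs n s \<le> gs n' s"
proof -
  have "incseq (\<lambda>n. gs n s)"
    using assms by (auto simp: simple_approx_def incseq_Suc_iff)
  then show ?thesis using assms(3) by (simp add: incseq_def)
qed

lemma simple_function_imp_simple_fun:
  fixes g :: "'e \<Rightarrow> real"
  assumes g: "simple_function m g" and pos: "\<And>s. s \<in> space m \<Longrightarrow> 0 \<le> g s"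
    and fin: "\<And>c. 0 < c \<Longrightarrow> emeasure m {s \<in> space m. g s = c} < \<infinity>"
  shows "simple_fun m g"
proof -
  \<comment> \<open>The value \<open>0\<close> is always included: a representation has at least one term.\<close>
  define V where "V = insert 0 (g ` space m)"
  have V: "finite V" "V \<noteq> {}" using simple_functionD(1)[OF g] by (auto simp: V_def)
  then obtain e where e: "bij_betw e {..<card V} V"
    using ex_bij_betw_nat_finite by (auto simp: atLeast0LessThan)
  define k where "k = card V - 1"
  have card: "{..<card V} = {..k}" using V by (auto simp: k_def card_gt_0_iff lessThan_Suc_atMost[symmetric])
  define A where "A j = (if e j = 0 then {} else {s \<in> space m. g s = e j})" for j
  have inj: "inj_on e {..k}" and img: "e ` {..k} = V"
    using e unfolding card by (auto simp: bij_betw_def)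
  have nonneg: "0 \<le> e j" if "j \<le> k" for j
  proof -
    have "e j \<in> V" using img that by blast
    then show ?thesis using pos by (auto simp: V_def)
  qed
  have A: "A j \<in> finite_sets m" if "j \<le> k" for j
  proof (cases "e j = 0")
    case True
    then show ?thesis by (simp add: A_def finite_sets_def)
  next
    case False
    have "g -` {e j} \<inter> space m \<in> sets m"
      by (rule simple_functionD(2)[OF g])
    moreover have "g -` {e j} \<inter> space m = {s \<in> space m. g s = e j}" by auto
    ultimately show ?thesis
      using False fin[of "e j"] nonneg[OF that] by (simp add: A_def finite_sets_def)
  qed
  have disj: "disjoint_family_on A {..k}"
    using inj by (auto simp: disjoint_family_on_def A_def inj_on_def)
  have "g s = (\<Sum>j\<le>k. e j * indicator (A j) s)" if s: "s \<in> space m" for s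
  proof -
    have "g s \<in> e ` {..k}" unfolding img using s by (simp add: V_def)
    then obtain j where j: "j \<le> k" "e j = g s" by auto
    have "(\<Sum>i\<le>k. e i * indicator (A i) s) = (\<Sum>i\<le>k. if i = j then g s else 0)"
    proof (rule sum.cong[OF refl])
      fix i assume "i \<in> {..k}"
      then have "e i = e j \<longleftrightarrow> i = j" using inj j by (auto simp: inj_on_def)
      then show "e i * indicator (A i) s = (if i = j then g s else 0)"
        using j s by (auto simp: A_def indicator_def)
    qed
    then show ?thesis using j by simp
  qed
  then have "simple_repr m g (k, e, A)"
    using A nonneg disj by (auto simp: simple_repr_def)
  then show ?thesis unfolding simple_fun_def by blast
qed

text \<open>Every nonnegative measurable function is an increasing limit of functions with finitely many
  values. Here their level sets for \<open>c > 0\<close> lie in \<open>g \<ge> c\<close>, which has finite measure by Markov's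
  inequality, so that the approximants are simple in the stricter sense required by the integral.\<close>

lemma Lp_plus_imp_simple_approx:
  assumes g: "g \<in> Lp_plus \<alpha> m" and \<alpha>: "0 < \<alpha>"
  shows "\<exists>gs. simple_approx m gs g"
proof -
  have [measurable]: "g \<in> borel_measurable m" and pos: "\<And>s. s \<in> space m \<Longrightarrow> 0 \<le> g s"
    and int: "(\<integral>\<^sup>+ s. ennreal (g s powr \<alpha>) \<partial>m) < \<infinity>"
    using g by (auto simp: Lp_plus_def)
  obtain F :: "nat \<Rightarrow> 'a \<Rightarrow> ennreal" where F: "\<And>i. simple_function m (F i)" "incseq F"
      "\<And>i x. F i x < top" "\<And>x. (SUP i. F i x) = ennreal (g x)"
    using borel_measurable_implies_simple_function_sequence'[of "\<lambda>x. ennreal (g x)" m] by auto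
  define gs where "gs i s = enn2real (F i s)" for i s
  have le: "gs i s \<le> g s" if "s \<in> space m" for i s
  proof -
    have "F i s \<le> ennreal (g s)"
      unfolding F(4)[symmetric] by (rule SUP_upper) simp
    then show ?thesis
      using pos[OF that] enn2real_mono[of "F i s" "ennreal (g s)"] by (simp add: gs_def)
  qed
  have level: "emeasure m {s \<in> space m. c \<le> g s} < \<infinity>" if c: "0 < c" for c
  proof -
    have "ennreal (c powr \<alpha>) * emeasure m {s \<in> space m. c \<le> g s} =
        (\<integral>\<^sup>+s. ennreal (c powr \<alpha>) * indicator {s \<in> space m. c \<le> g s} s \<partial>m)"
      by (rule nn_integral_cmult_indicator[symmetric]) measurable
    also have "\<dots> \<le> (\<integral>\<^sup>+s. ennreal (g s powr \<alpha>) \<partial>m)"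
      using c \<alpha> by (intro nn_integral_mono) (auto simp: indicator_def intro!: ennreal_leI powr_mono2)
    finally have "ennreal (c powr \<alpha>) * emeasure m {s \<in> space m. c \<le> g s} < top"
      using int by (auto intro: order.strict_trans1)
    then show ?thesis
      using c by (auto simp: ennreal_mult_less_top)
  qed
  have simple: "simple_fun m (gs i)" for i
  proof (rule simple_function_imp_simple_fun)
    have "simple_function m (enn2real \<circ> F i)"
      by (rule simple_function_compose[OF F(1)])
    then show "simple_function m (gs i)" by (simp add: gs_def[abs_def] comp_def)
    show "0 \<le> gs i s" for s by (simp add: gs_def)
    show "emeasure m {s \<in> space m. gs i s = c} < \<infinity>" if "0 < c" for c
    proof -
      have "emeasure m {s \<in> space m. gs i s = c} \<le> emeasure m {s \<in> space m. c \<le> g s}"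
        using le by (intro emeasure_mono) auto
      then show ?thesis using level[OF that] by (rule order.strict_trans1)
    qed
  qed
  have "gs n s \<le> gs (Suc n) s" for n s
    using F(2,3) by (auto simp: gs_def incseq_Suc_iff le_fun_def intro!: enn2real_mono)
  moreover have "(\<lambda>n. gs n s) \<longlonglongrightarrow> g s" if "s \<in> space m" for s
  proof -
    have "incseq (\<lambda>n. F n s)" using F(2) by (auto simp: incseq_def le_fun_def)
    then have "(\<lambda>n. F n s) \<longlonglongrightarrow> ennreal (g s)"
      using LIMSEQ_SUP[of "\<lambda>n. F n s"] by (simp add: F(4))
    then show ?thesis
      unfolding gs_def using pos[OF that] by (rule tendsto_enn2real)
  qed
  ultimately have "simple_approx m gs g"
    using simple by (auto simp: simple_approx_def)
  then show ?thesis by blast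
qed


section \<open>Integrability\<close>

context sup_measure
begin

text \<open>The minimum of two approximating sequences again increases to \<open>g\<close>, so by monotone convergence
  it eventually exhausts the norm of \<open>g\<close>, while the maximum never exceeds it.\<close>

lemma simple_approx_integrals_close:
  assumes g: "g \<in> Lp_plus \<alpha> m" and gs: "simple_approx m gs g" and gs': "simple_approx m gs' g"
    and \<epsilon>: "0 < \<epsilon>" and \<theta>: "0 < \<theta>"
  shows "\<exists>N. \<forall>n\<ge>N. \<forall>k\<ge>N.
    prob {\<omega> \<in> space P. \<epsilon> < dist (sup_integral f m M (gs n) \<omega>) (sup_integral f m M (gs' k) \<omega>)} < \<theta>"
proof -
  define \<Gamma> where "\<Gamma> = enn2real (\<integral>\<^sup>+ s. ennreal (g s powr \<alpha>) \<partial>m)"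
  have \<Gamma>: "(\<integral>\<^sup>+ s. ennreal (g s powr \<alpha>) \<partial>m) = ennreal \<Gamma>" "0 \<le> \<Gamma>"
    using g by (auto simp: Lp_plus_def \<Gamma>_def)
  have simple: "simple_fun m (gs n)" "simple_fun m (gs' n)" for n
    using gs gs' by (auto simp: simple_approx_def)
  note nonneg = simple_fun_nonneg[OF simple(1)] simple_fun_nonneg[OF simple(2)]
  obtain \<eta> where \<eta>: "0 < \<eta>" and close: "\<forall>p q. simple_fun m p \<longrightarrow> simple_fun m q \<longrightarrow>
      (\<integral>\<^sup>+s. ennreal (max (p s) (q s) powr \<alpha>) \<partial>m) \<le> ennreal \<Gamma> \<longrightarrow>
      ennreal (\<Gamma> - \<eta>) \<le> (\<integral>\<^sup>+s. ennreal (min (p s) (q s) powr \<alpha>) \<partial>m) \<longrightarrow>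
      prob {\<omega> \<in> space P. \<epsilon> < dist (sup_integral f m M p \<omega>) (sup_integral f m M q \<omega>)} < \<theta>"
    using sup_integrals_close[OF \<Gamma>(2) \<epsilon> \<theta>] by blast
  have "(\<lambda>n. \<integral>\<^sup>+s. ennreal (min (gs n s) (gs' n s) powr \<alpha>) \<partial>m) \<longlonglongrightarrow> (\<integral>\<^sup>+s. ennreal (g s powr \<alpha>) \<partial>m)"
  proof (rule nn_integral_powr_tendsto[OF _ _ _ _ \<alpha>])
    show "(\<lambda>s. min (gs n s) (gs' n s)) \<in> borel_measurable m" for n
      using simple_fun_measurable[OF simple(1)] simple_fun_measurable[OF simple(2)] by measurable
    show "0 \<le> min (gs n s) (gs' n s)" if "s \<in> space m" for n s
      using nonneg that by simp
    show "min (gs n s) (gs' n s) \<le> min (gs (Suc n) s) (gs' (Suc n) s)" if "s \<in> space m" for n s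
      using that gs gs' by (intro min.mono) (auto simp: simple_approx_def)
    show "(\<lambda>n. min (gs n s) (gs' n s)) \<longlonglongrightarrow> g s" if "s \<in> space m" for s
    proof -
      have "(\<lambda>n. min (gs n s) (gs' n s)) \<longlonglongrightarrow> min (g s) (g s)"
        using that gs gs' by (intro tendsto_min) (auto simp: simple_approx_def)
      then show ?thesis by simp
    qed
  qed
  then have lim: "(\<lambda>n. \<integral>\<^sup>+s. ennreal (min (gs n s) (gs' n s) powr \<alpha>) \<partial>m) \<longlonglongrightarrow> ennreal \<Gamma>"
    by (simp add: \<Gamma>)
  obtain N where N: "ennreal (\<Gamma> - \<eta>) \<le> (\<integral>\<^sup>+s. ennreal (min (gs N s) (gs' N s) powr \<alpha>) \<partial>m)"
  proof (cases "\<Gamma> - \<eta> \<le> 0")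
    case True
    then show ?thesis using that[of 0] by (simp add: ennreal_neg)
  next
    case False
    then have "ennreal (\<Gamma> - \<eta>) < ennreal \<Gamma>"
      using \<eta> by (intro ennreal_lessI) auto
    from order_tendstoD(1)[OF lim this] show ?thesis
      using that by (auto simp: eventually_sequentially intro: less_imp_le)
  qed
  show ?thesis
  proof (intro exI allI impI)
    fix n k assume nk: "N \<le> n" "N \<le> k"
    have "(\<integral>\<^sup>+s. ennreal (max (gs n s) (gs' k s) powr \<alpha>) \<partial>m) \<le> ennreal \<Gamma>"
      unfolding \<Gamma>(1)[symmetric]
      using nonneg \<alpha> simple_approx_le[OF gs] simple_approx_le[OF gs']
      by (intro nn_integral_mono ennreal_leI powr_mono2) (auto simp: le_max_iff_disj)
    moreover have "ennreal (\<Gamma> - \<eta>) \<le> (\<integral>\<^sup>+s. ennreal (min (gs n s) (gs' k s) powr \<alpha>) \<partial>m)"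
      using N
    proof (rule order_trans)
      show "(\<integral>\<^sup>+s. ennreal (min (gs N s) (gs' N s) powr \<alpha>) \<partial>m) \<le>
          (\<integral>\<^sup>+s. ennreal (min (gs n s) (gs' k s) powr \<alpha>) \<partial>m)"
        using nonneg \<alpha> simple_approx_mono[OF gs _ nk(1)] simple_approx_mono[OF gs' _ nk(2)]
        by (intro nn_integral_mono ennreal_leI powr_mono2 min.mono) auto
    qed
    ultimately show "prob {\<omega> \<in> space P. \<epsilon> < dist (sup_integral f m M (gs n) \<omega>) (sup_integral f m M (gs' k) \<omega>)} < \<theta>"
      using close simple by blast
  qed
qed

lemma simple_approx_integrals_converge:
  assumes g: "g \<in> Lp_plus \<alpha> m" and gs: "simple_approx m gs g"
  shows "\<exists>Y. converges_in_prob P (\<lambda>n. sup_integral f m M (gs n)) Y"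
proof (rule cauchy_in_prob_imp_converges_in_prob)
  show "sup_integral f m M (gs n) \<in> borel_measurable P" for n
    using gs by (intro sup_integral_measurable) (simp add: simple_approx_def)
qed (rule simple_approx_integrals_close[OF g gs gs])

lemma simple_approx_limits_AE_eq:
  assumes g: "g \<in> Lp_plus \<alpha> m" and gs: "simple_approx m gs g" and gs': "simple_approx m gs' g"
    and Y: "converges_in_prob P (\<lambda>n. sup_integral f m M (gs n)) Y"
    and Y': "converges_in_prob P (\<lambda>n. sup_integral f m M (gs' n)) Y'"
  shows "AE \<omega> in P. Y \<omega> = Y' \<omega>"
proof (rule converges_in_prob_limits_AE_eq[OF Y Y'])
  fix \<epsilon> :: real assume \<epsilon>: "0 < \<epsilon>"
  show "(\<lambda>n. prob {\<omega> \<in> space P. \<epsilon> < dist (sup_integral f m M (gs n) \<omega>) (sup_integral f m M (gs' n) \<omega>)}) \<longlonglongrightarrow> 0"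
  proof (rule LIMSEQ_I)
    fix \<theta> :: real assume "0 < \<theta>"
    from simple_approx_integrals_close[OF g gs gs' \<epsilon> this]
    show "\<exists>no. \<forall>n\<ge>no. norm (prob {\<omega> \<in> space P. \<epsilon> < dist (sup_integral f m M (gs n) \<omega>)
        (sup_integral f m M (gs' n) \<omega>)} - 0) < \<theta>"
      by auto
  qed
qed

text \<open>Convergence in probability keeps \<open>f (I (gs n)) \<le> B\<close> likely for some fixed \<open>B\<close>. This event has
  probability \<open>exp (- (L n * B powr (- \<alpha>)))\<close>, which would vanish if the integrals \<open>L n\<close> of
  \<open>gs n powr \<alpha>\<close> grew without bound.\<close>

lemma convergent_integrals_imp_Lp_plus:
  assumes meas: "g \<in> borel_measurable m" and pos: "\<forall>s\<in>space m. 0 \<le> g s"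
    and gs: "simple_approx m gs g"
    and Y: "converges_in_prob P (\<lambda>n. sup_integral f m M (gs n)) Y"
  shows "g \<in> Lp_plus \<alpha> m"
proof (rule ccontr)
  assume "g \<notin> Lp_plus \<alpha> m"
  then have inf: "(\<integral>\<^sup>+ s. ennreal (g s powr \<alpha>) \<partial>m) = \<infinity>"
    using meas pos by (auto simp: Lp_plus_def less_top[symmetric])
  have simple: "simple_fun m (gs n)" for n
    using gs by (auto simp: simple_approx_def)
  define L where "L n = enn2real (\<integral>\<^sup>+s. ennreal (gs n s powr \<alpha>) \<partial>m)" for n
  have L: "(\<integral>\<^sup>+s. ennreal (gs n s powr \<alpha>) \<partial>m) = ennreal (L n)" "0 \<le> L n" for n
  proof -
    obtain k a A where "simple_repr m (gs n) (k, a, A)"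
      using simple[of n] by (auto simp: simple_fun_def)
    from step_nn_integral_powr[OF simple_repr_step_on[OF this], of \<alpha>]
    show "(\<integral>\<^sup>+s. ennreal (gs n s powr \<alpha>) \<partial>m) = ennreal (L n)"
      by (simp add: L_def)
  qed (simp add: L_def)
  have lim: "(\<lambda>n. ennreal (L n)) \<longlonglongrightarrow> \<infinity>"
    unfolding L(1)[symmetric] inf[symmetric]
    using gs simple_fun_measurable[OF simple] simple_fun_nonneg[OF simple]
    by (intro nn_integral_powr_tendsto \<alpha>) (auto simp: simple_approx_def)
  obtain K where K: "eventually (\<lambda>n. prob {\<omega> \<in> space P. K < norm (sup_integral f m M (gs n) \<omega>)} < 1/2) sequentially"
    using converges_in_prob_imp_tight[OF Y, of "1/2"] by auto
  obtain B where B: "0 < B" "\<And>x. norm x \<le> K \<Longrightarrow> f x \<le> B"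
    using loss_function_bounded_on_balls[OF loss, of K] by blast
  have "eventually (\<lambda>n. ennreal (B powr \<alpha>) < ennreal (L n)) sequentially"
    using order_tendstoD(1)[OF lim, of "ennreal (B powr \<alpha>)"] by simp
  from eventually_happens[OF eventually_conj[OF this K]]
  obtain n where n: "B powr \<alpha> \<le> L n" "prob {\<omega> \<in> space P. K < norm (sup_integral f m M (gs n) \<omega>)} < 1/2"
    using B(1) by (auto simp: ennreal_less_iff intro: less_imp_le)
  note [measurable] = sup_integral_measurable[OF simple] loss_function_measurable[OF loss]
  have "1/2 < 1 - prob {\<omega> \<in> space P. K < norm (sup_integral f m M (gs n) \<omega>)}"
    using n(2) by simp
  also have "\<dots> = prob (space P - {\<omega> \<in> space P. K < norm (sup_integral f m M (gs n) \<omega>)})"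
    by (rule prob_compl[symmetric]) measurable
  also have "\<dots> \<le> prob {\<omega> \<in> space P. f (sup_integral f m M (gs n) \<omega>) \<le> B}"
    using B(2) by (intro finite_measure_mono) (auto simp: not_less)
  also have "\<dots> = exp (- (L n * B powr (- \<alpha>)))"
    using loss_repr_integral_le[OF repr_of_simple_fun[OF simple] L B(1)]
    by (simp add: sup_integral_def)
  also have "\<dots> \<le> exp (- 1)"
  proof -
    have "1 = B powr \<alpha> * B powr (- \<alpha>)" using B(1) by (simp add: powr_minus)
    also have "\<dots> \<le> L n * B powr (- \<alpha>)" using n(1) by (rule mult_right_mono) simp
    finally show ?thesis by simp
  qed
  also have "\<dots> \<le> 1/2"
    using exp_ge_add_one_self[of "1::real"] by (simp add: exp_minus field_simps)
  finally show False by simp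
qed

end

theorem theorem3p11:
  fixes f :: "real ^ 'n \<Rightarrow> real" and \<alpha> :: real and \<kappa> :: "(real ^ 'n) measure"
    and m :: "'e measure" and P :: "'w measure" and M :: "'e set \<Rightarrow> 'w \<Rightarrow> real ^ 'n"
  assumes "loss_function f"
    and "0 < \<alpha>"
    and "prob_space \<kappa>" and "sets \<kappa> = sets (restrict_space borel (loss_sphere f))"
    and "sigma_finite_measure m"
    and "prob_space P"
    and "frechet_sup_measure f \<alpha> \<kappa> m P M"
  shows "sup_integrable_functions f m P M = Lp_plus \<alpha> m
    \<and> (\<forall>g \<in> Lp_plus \<alpha> m.
         (\<forall>gs. simple_approx m gs g \<longrightarrow>
            (\<exists>Y. converges_in_prob P (\<lambda>n. sup_integral f m M (gs n)) Y)) \<and>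
         (\<forall>gs gs' Y Y'. simple_approx m gs g \<longrightarrow> simple_approx m gs' g \<longrightarrow>
            converges_in_prob P (\<lambda>n. sup_integral f m M (gs n)) Y \<longrightarrow>
            converges_in_prob P (\<lambda>n. sup_integral f m M (gs' n)) Y' \<longrightarrow>
            (AE \<omega> in P. Y \<omega> = Y' \<omega>)))"
proof -
  interpret sup_measure P f \<alpha> \<kappa> m M
    by (intro sup_measure.intro sup_measure_axioms.intro) (fact assms)+
  have "sup_integrable_functions f m P M = Lp_plus \<alpha> m"
  proof (intro equalityI subsetI)
    fix g assume "g \<in> sup_integrable_functions f m P M"
    then show "g \<in> Lp_plus \<alpha> m"
      unfolding sup_integrable_functions_def using convergent_integrals_imp_Lp_plus by blast
  next
    fix g assume g: "g \<in> Lp_plus \<alpha> m"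
    obtain gs where gs: "simple_approx m gs g"
      using Lp_plus_imp_simple_approx[OF g \<alpha>] by blast
    obtain Y where "converges_in_prob P (\<lambda>n. sup_integral f m M (gs n)) Y"
      using simple_approx_integrals_converge[OF g gs] by blast
    then show "g \<in> sup_integrable_functions f m P M"
      using g gs by (auto simp: sup_integrable_functions_def Lp_plus_def)
  qed
  then show ?thesis
    using simple_approx_integrals_converge simple_approx_limits_AE_eq by blast
qed

end
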